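(* Let $0<\epsilon\le 1/e$, $\gamma>1$, and let $n\in\mathbb{N}$ with $n\ge\sqrt{\gamma^2-1}\,\log(1/\epsilon)$. Set $$m=\left\lceil \frac{36\,n\log(1/\epsilon)}{\sqrt{\gamma^2-1}}\right\rceil,\qquad \epsilon'=\frac{\epsilon(n+1)}{\sqrt{\gamma}},$$ and consider the polynomial frame approximation $\mathcal{P}^{\epsilon',\gamma}_{m,n}$ (with truncation threshold $\epsilon'$). Let $c=4\beta+3$, where $\beta$ is the Coppersmith–Rivlin constant. Then $$\kappa(\mathcal{P}^{\epsilon',\gamma}_{m,n})\le c\sqrt{m+1}.$$ Moreover, if $\theta>\gamma+\sqrt{\gamma^2-1}$, then for all $f\in B(E_\theta)$, $$\|f-\mathcal{P}^{\epsilon',\gamma}_{m,n}(f)\|_{[-1,1],\infty}\le c\,g(\theta,\gamma)\sqrt{m}\,\big(\theta^{-n}+n\epsilon\big)\|f\|_{E_\theta,\infty}$$ and $$\|f-\mathcal{P}^{\epsilon',\gamma}_{m,n}(f)\|_{[-1,1],\infty}\le c\,g(\theta,\gamma)\sqrt{m}\,\big(\rho^{1-m}+m\epsilon\big)\|f\|_{E_\theta,\infty},$$ where $g(\theta,\gamma)$ depends on $\theta$ and $\gamma$ only (not on $\epsilon,n,m,f$), and $$\rho=\theta^{c_*},\qquad c_*=\frac{\sqrt{\gamma^2-1}}{36\log(1/\epsilon)}.$$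
   Context: $\mathbb{P}_n$ is the space of complex polynomials of degree at most $n$. For a set $I$, $\|g\|_{I,\infty}=\sup_{x\in I}|g(x)|$. For $m\ge1$, $x_i=-1+2i/m$, $i=0,\dots,m$, and $\|g\|_{m,\infty}=\max_{0\le i\le m}|g(x_i)|$. $C([-1,1])$ is the space of continuous complex-valued functions on $[-1,1]$. Bernstein ellipse: for $\theta>1$, $E_\theta=\{\tfrac12(z+z^{-1}): z\in\mathbb{C},\ 1\le|z|\le\theta\}$. For compact $E\subset\mathbb{C}$, $B(E)$ is the set of functions continuous on $E$ and analytic in its interior, and $\|f\|_{E,\infty}=\sup_{z\in E}|f(z)|$. Functions in $B(E_\theta)$ are regarded as elements of $C([-1,1])$ by restriction. Polynomial frame approximation with threshold $\epsilon\ge 0$: let $P_i$ be the classical Legendre polynomial with $P_i(1)=1$, and $\psi_i(x)=\sqrt{i+1/2}\,P_i(x/\gamma)/\sqrt{\gamma}$, $i\ge0$ (orthonormal in $L^2([-\gamma,\gamma])$). Let $A=\sqrt{2/(m+1)}\,(\psi_j(x_i))_{i=0,\dots,m;\ j=0,\dots,n}$ be the $(m+1)\times(n+1)$ matrix with SVD $A=U\Sigma V^*$, singular values $\sigma_i$. Let $\Sigma^{\epsilon,\dagger}$ be the $(n+1)\times(m+1)$ diagonal matrix with diagonal entries $1/\sigma_i$ if $\sigma_i>\epsilon$ and $0$ otherwise. For $f\in C([-1,1])$ let $b=\sqrt{2/(m+1)}\,(f(x_i))_{i=0}^m$, $\hat c^{\epsilon}=V\Sigma^{\epsilon,\dagger}U^*b$,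 and $\mathcal{P}^{\epsilon,\gamma}_{m,n}(f)=\sum_{i=0}^n\hat c^{\epsilon}_i\psi_i$, viewed as a map $C([-1,1])\to C([-1,1])$. Condition number: for a map $\mathcal{R}:C([-1,1])\to C([-1,1])$ depending on $f$ only through $(f(x_i))_{i=0}^m$, $$\kappa(\mathcal{R})=\sup_{f\in C([-1,1])}\ \lim_{\delta\to0^+}\ \sup_{\substack{h\in C([-1,1])\\ 0<\|h\|_{m,\infty}\le\delta}}\frac{\|\mathcal{R}(f+h)-\mathcal{R}(f)\|_{[-1,1],\infty}}{\|h\|_{m,\infty}}.$$ Coppersmith–Rivlin constant: let $B(m,n)=\sup\{\|p\|_{[-1,1],\infty}: p\in\mathbb{P}_n,\ \|p\|_{m,\infty}\le1\}$. By a known theorem of Coppersmith and Rivlin there exist constants $\beta\ge\alpha>1$ such that $\alpha^{n^2/m}\le B(m,n)\le\beta^{n^2/m}$ for all integers $1\le n\le m$. Fix such a $\beta$. *)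

theory Defs
  imports
    "HOL-Complex_Analysis.Complex_Analysis"
    "Jordan_Normal_Form.Schur_Decomposition"
begin

section \<open>Norms, the equispaced grid and Bernstein ellipses\<close>

text \<open>Real-valued supremum; it is only meaningful (and only used) for functions that are bounded
  on the set, namely continuous functions on compact sets.\<close>

definition sup_norm :: "'a set \<Rightarrow> ('a \<Rightarrow> complex) \<Rightarrow> real" where
  "sup_norm I g = (SUP x\<in>I. cmod (g x))"

definition grid_pt :: "nat \<Rightarrow> nat \<Rightarrow> real" where
  "grid_pt m i = - 1 + 2 * real i / real m"

definition grid_norm :: "nat \<Rightarrow> (real \<Rightarrow> complex) \<Rightarrow> real" where
  "grid_norm m g = Max ((\<lambda>i. cmod (g (grid_pt m i))) ` {0..m})"

text \<open>\<open>C([-1,1])\<close>: functions on the line of which only the values on \<open>[-1,1]\<close> matter.\<close>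

definition C_interval :: "(real \<Rightarrow> complex) set" where
  "C_interval = {f. continuous_on {-1..1} f}"

definition bernstein_ellipse :: "real \<Rightarrow> complex set" where
  "bernstein_ellipse \<theta> = {(z + inverse z) / 2 | z. 1 \<le> cmod z \<and> cmod z \<le> \<theta>}"

definition B_space :: "complex set \<Rightarrow> (complex \<Rightarrow> complex) set" where
  "B_space E = {f. continuous_on E f \<and> f analytic_on interior E}"

definition restrict_real :: "(complex \<Rightarrow> complex) \<Rightarrow> real \<Rightarrow> complex" where
  "restrict_real f = (\<lambda>x. f (complex_of_real x))"

section \<open>Legendre polynomials\<close>

text \<open>Rodrigues' formula.\<close>

definition legendre :: "nat \<Rightarrow> real poly" where
  "legendre i = Polynomial.smult (1 / (2 ^ i * fact i)) ((pderiv ^^ i) ([:- 1, 0, 1:] ^ i))"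

lemma poly_higher_pderiv_at_1:
  fixes q :: "real poly"
  shows "poly ((pderiv ^^ k) ([:- 1, 1:] ^ k * q)) 1 = fact k * poly q 1"
proof (induction k arbitrary: q)
  case 0
  show ?case by simp
next
  case (Suc k)
  have p1: "pderiv [:- 1, 1::real:] = 1"
    by (simp add: pderiv_pCons one_pCons)
  have "pderiv ([:- 1, 1:] ^ Suc k * q) =
      [:- 1, 1:] ^ k * (Polynomial.smult (of_nat (Suc k)) q + [:- 1, 1:] * pderiv q)"
    by (simp only: pderiv_mult pderiv_power_Suc p1) (simp add: algebra_simps del: mult_pCons_left mult_pCons_right)
  then show ?case
    by (simp only: funpow_Suc_right o_apply Suc.IH) (simp add: algebra_simps)
qed

lemma legendre_at_1: "poly (legendre i) 1 = 1"
proof -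
  have "[:- 1, 0, 1:] = [:- 1, 1:] * [:1, 1::real:]"
    by simp
  then have "[:- 1, 0, 1:] ^ i = [:- 1, 1:] ^ i * [:1, 1::real:] ^ i"
    by (simp only: power_mult_distrib)
  then show ?thesis
    unfolding legendre_def
    by (simp only: poly_smult poly_higher_pderiv_at_1) simp
qed

definition psi :: "real \<Rightarrow> nat \<Rightarrow> real \<Rightarrow> real" where
  "psi \<gamma> i x = sqrt (real i + 1 / 2) * poly (legendre i) (x / \<gamma>) / sqrt \<gamma>"

section \<open>Singular value decompositions and polynomial frame approximation\<close>

definition unitary_mat :: "complex mat \<Rightarrow> nat \<Rightarrow> bool" where
  "unitary_mat U k \<longleftrightarrow> U \<in> carrier_mat k k \<and> mat_adjoint U * U = 1\<^sub>m k \<and> U * mat_adjoint U = 1\<^sub>m k"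

text \<open>A full decomposition \<open>A = U S V\<^sup>*\<close> with \<open>S\<close> rectangular, diagonal, with nonnegative real diagonal.
  No ordering of the singular values is imposed.\<close>

definition is_svd :: "complex mat \<Rightarrow> complex mat \<Rightarrow> complex mat \<Rightarrow> complex mat \<Rightarrow> bool" where
  "is_svd A U S V \<longleftrightarrow>
     unitary_mat U (dim_row A) \<and> unitary_mat V (dim_col A) \<and>
     S \<in> carrier_mat (dim_row A) (dim_col A) \<and> diagonal_mat S \<and>
     (\<forall>i < min (dim_row A) (dim_col A). S $$ (i, i) \<in> \<real> \<and> 0 \<le> Re (S $$ (i, i))) \<and>
     A = U * S * mat_adjoint V"

definition trunc_pinv :: "real \<Rightarrow> complex mat \<Rightarrow> complex mat" where
  "trunc_pinv \<epsilon> S = Matrix.mat (dim_col S) (dim_row S)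
     (\<lambda>(i, j). if i = j \<and> \<epsilon> < Re (S $$ (i, i)) then 1 / S $$ (i, i) else 0)"

definition frame_mat :: "real \<Rightarrow> nat \<Rightarrow> nat \<Rightarrow> complex mat" where
  "frame_mat \<gamma> m n = Matrix.mat (m + 1) (n + 1)
     (\<lambda>(i, j). complex_of_real (sqrt (2 / (real m + 1)) * psi \<gamma> j (grid_pt m i)))"

definition data_vec :: "nat \<Rightarrow> (real \<Rightarrow> complex) \<Rightarrow> complex Matrix.vec" where
  "data_vec m f = Matrix.vec (m + 1)
     (\<lambda>i. complex_of_real (sqrt (2 / (real m + 1))) * f (grid_pt m i))"

definition frame_coeffs ::
  "complex mat \<Rightarrow> complex mat \<Rightarrow> complex mat \<Rightarrow> real \<Rightarrow> nat \<Rightarrow> (real \<Rightarrow> complex) \<Rightarrow> complex Matrix.vec" where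
  "frame_coeffs U S V \<epsilon> m f =
     (V * trunc_pinv \<epsilon> S * mat_adjoint U) *\<^sub>v data_vec m f"

text \<open>The approximation computed from a decomposition \<open>U, S, V\<close> of \<open>frame_mat \<gamma> m n\<close>. The resulting
  operator does not depend on which decomposition is used.\<close>

definition frame_approx ::
  "complex mat \<Rightarrow> complex mat \<Rightarrow> complex mat \<Rightarrow> real \<Rightarrow> real \<Rightarrow> nat \<Rightarrow> nat \<Rightarrow> (real \<Rightarrow> complex) \<Rightarrow> real \<Rightarrow> complex" where
  "frame_approx U S V \<epsilon> \<gamma> m n f =
     (\<lambda>x. \<Sum>i = 0..n. vec_index (frame_coeffs U S V \<epsilon> m f) i * complex_of_real (psi \<gamma> i x))"

section \<open>Condition number and the Coppersmith--Rivlin constant\<close>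

definition cond_number :: "nat \<Rightarrow> ((real \<Rightarrow> complex) \<Rightarrow> real \<Rightarrow> complex) \<Rightarrow> ereal" where
  "cond_number m R =
     (SUP f\<in>C_interval.
        Lim (at_right (0::real)) (\<lambda>\<delta>.
          SUP h\<in>{h \<in> C_interval. 0 < grid_norm m h \<and> grid_norm m h \<le> \<delta>}.
            ereal (sup_norm {-1..1} (\<lambda>x. R (\<lambda>t. f t + h t) x - R f x) / grid_norm m h)))"

definition CR_B :: "nat \<Rightarrow> nat \<Rightarrow> ereal" where
  "CR_B m n =
     (SUP p\<in>{p :: complex poly. degree p \<le> n \<and> grid_norm m (restrict_real (poly p)) \<le> 1}.
        ereal (sup_norm {-1..1} (restrict_real (poly p))))"

text \<open>Only the upper Coppersmith--Rivlin bound is required of \<open>\<beta>\<close>. The companion lower bound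
  \<open>\<alpha> powr (n\<^sup>2 / m) \<le> CR_B m n\<close> with \<open>\<alpha> > 1\<close> cannot hold for all \<open>1 \<le> n \<le> m\<close>
  (\<open>CR_B m 1 = 1\<close>, as both endpoints are grid points), so demanding it would leave no admissible \<open>\<beta>\<close>.\<close>

definition CR_constant :: "real \<Rightarrow> bool" where
  "CR_constant \<beta> \<longleftrightarrow> 1 < \<beta> \<and>
     (\<forall>m n. 1 \<le> n \<and> n \<le> m \<longrightarrow> CR_B m n \<le> ereal (\<beta> powr ((real n)\<^sup>2 / real m)))"

end

theory Submission
  imports Defs
begin

text \<open>Write \<open>L = ln (1 / \<epsilon>)\<close> and \<open>s = sqrt (\<gamma>\<^sup>2 - 1)\<close>. The frame approximation of data of size at most
  \<open>1\<close> is a polynomial \<open>p\<close> of degree at most \<open>n\<close> which is bounded by \<open>sqrt (m + 1)\<close> on the grid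
  (\<open>A \<Sigma>\<^sup>\<dagger>\<close> is a partial isometry) and by \<open>1 / \<epsilon>\<close> on \<open>[-\<gamma>, \<gamma>]\<close> (by the truncation at \<open>\<epsilon>'\<close>, the
  coefficient vector is bounded, and \<open>\<bar>P\<^sub>i\<bar> \<le> 1\<close>). By the Bernstein--Walsh inequality such a polynomial
  grows at most by the factor \<open>exp (n r / s)\<close> in the disc of radius \<open>r\<close> around a point of \<open>[-1, 1]\<close>.
  Hence on a window of \<open>k\<^sup>2\<close> grid intervals, with \<open>k\<close> about \<open>6 L\<close>, it agrees up to \<open>O(1)\<close> with a Taylor
  polynomial of degree \<open>k\<close>, and the Coppersmith--Rivlin bound for degree \<open>k\<close> and \<open>k\<^sup>2\<close> intervals is just
  \<open>\<beta>\<close>. This bounds the condition number. For the error, \<open>f\<close> is compared with a polynomial \<open>q\<close> obtained by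
  truncating its Chebyshev expansion: \<open>f - q\<close> is of order \<open>\<theta>\<^sup>-\<^sup>n\<close> on \<open>[-1, 1]\<close>, while \<open>q\<close> is bounded on
  \<open>[-\<gamma>, \<gamma>]\<close> independently of \<open>n\<close>, so that its coefficients are bounded and the truncation perturbs \<open>q\<close>
  by a multiple of \<open>\<epsilon>'\<close> only.\<close>

section \<open>Legendre polynomials\<close>

text \<open>Leibniz' rule stops after three terms, since the quadratic has no third derivative. The
  truncated subtractions \<open>k - 1\<close> and \<open>k - 2\<close> are harmless: where they
  truncate, the factors \<open>real k\<close> or \<open>real k - 1\<close> vanish.\<close>

lemma higher_pderiv_quadratic_mult:
  fixes q :: "real poly"
  shows "(pderiv ^^ k) ([:- 1, 0, 1:] * q) = [:- 1, 0, 1:] * (pderiv ^^ k) q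
    + Polynomial.smult (2 * real k) ([:0, 1:] * (pderiv ^^ (k - 1)) q)
    + Polynomial.smult (real k * (real k - 1)) ((pderiv ^^ (k - 2)) q)"
proof (induction k)
  case (Suc k)
  have d: "pderiv [:- 1, 0, 1:] = Polynomial.smult 2 [:0, 1::real:]" "pderiv [:0, 1::real:] = 1"
    by (simp_all add: pderiv_pCons one_pCons)
  show ?case
  proof (cases k)
    case 0
    then show ?thesis
      by (simp add: pderiv_mult d del: mult_pCons_left mult_pCons_right)
        (simp add: poly_eq_poly_eq_iff[symmetric] fun_eq_iff)
  next
    case (Suc j)
    show ?thesis
    proof (cases j)
      case 0
      then show ?thesis using Suc.IH Suc
        by (simp add: pderiv_mult pderiv_add pderiv_smult d algebra_simps del: mult_pCons_left mult_pCons_right)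
          (simp add: poly_eq_poly_eq_iff[symmetric] fun_eq_iff algebra_simps)
    next
      case (Suc i)
      then show ?thesis using Suc.IH \<open>k = Suc j\<close>
        by (simp add: pderiv_mult pderiv_add pderiv_smult d algebra_simps del: mult_pCons_left mult_pCons_right)
          (simp add: poly_eq_poly_eq_iff[symmetric] fun_eq_iff algebra_simps)
    qed
  qed
qed simp

lemma higher_pderiv_X_mult:
  fixes q :: "real poly"
  shows "(pderiv ^^ k) ([:0, 1:] * q) = [:0, 1:] * (pderiv ^^ k) q
    + Polynomial.smult (real k) ((pderiv ^^ (k - 1)) q)"
proof (induction k)
  case (Suc k)
  have d: "pderiv [:0, 1::real:] = 1"
    by (simp_all add: pderiv_pCons one_pCons)
  show ?case
  proof (cases k)
    case 0
    then show ?thesis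
      by (simp add: pderiv_mult d del: mult_pCons_left mult_pCons_right)
  next
    case (Suc j)
    then show ?thesis using Suc.IH
        by (simp add: pderiv_mult pderiv_add pderiv_smult d algebra_simps del: mult_pCons_left mult_pCons_right)
          (simp add: poly_eq_poly_eq_iff[symmetric] fun_eq_iff algebra_simps)
  qed
qed simp

text \<open>\<open>u = (x^2 - 1)^i\<close> solves the first order equation
  \<open>(x^2 - 1) u' = 2 i x u\<close>. Differentiating it \<open>i + 1\<close> times by the two
  Leibniz rules gives a second order equation for the \<open>i\<close>-th derivative of
  \<open>u\<close>, of which the Legendre polynomial is a multiple.\<close>

lemma legendre_ode:
  "(1 - x\<^sup>2) * poly (pderiv (pderiv (legendre i))) x
    = 2 * x * poly (pderiv (legendre i)) x - real i * (real i + 1) * poly (legendre i) x"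
proof -
  define u :: "real poly" where "u = [:- 1, 0, 1:] ^ i"
  define Q where "Q = (pderiv ^^ i) u"
  have u': "[:- 1, 0, 1:] * pderiv u = Polynomial.smult (2 * real i) ([:0, 1:] * u)"
  proof (cases i)
    case (Suc j)
    have d: "pderiv [:- 1, 0, 1:] = Polynomial.smult 2 [:0, 1::real:]"
      by (simp_all add: pderiv_pCons one_pCons)
    show ?thesis unfolding u_def Suc pderiv_power_Suc d
      by (simp add: poly_eq_poly_eq_iff[symmetric] fun_eq_iff algebra_simps)
  qed (simp add: u_def)
  have p1: "pderiv Q = (pderiv ^^ i) (pderiv u)" "pderiv (pderiv Q) = (pderiv ^^ Suc i) (pderiv u)"
    by (simp_all add: Q_def funpow_swap1)
  have p2: "(pderiv ^^ Suc i) u = pderiv Q" by (simp add: Q_def)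
  \<comment> \<open>For \<open>i = 0\<close> the index \<open>Suc i - 2\<close> is truncated and the
    derivatives differ, but then the factor \<open>real i\<close> is zero.\<close>
  have p3: "real i * (real i + 1) * poly ((pderiv ^^ (Suc i - 2)) (pderiv u)) x = real i * (real i + 1) * poly Q x"
    by (cases i) (simp_all add: Q_def funpow_swap1)
  have "poly ((pderiv ^^ Suc i) ([:- 1, 0, 1:] * pderiv u)) x
      = poly ((pderiv ^^ Suc i) (Polynomial.smult (2 * real i) ([:0, 1:] * u))) x"
    by (simp only: u')
  then have "(x\<^sup>2 - 1) * poly (pderiv (pderiv Q)) x + 2 * (real i + 1) * x * poly (pderiv Q) x
      + real i * (real i + 1) * poly Q x
      = 2 * real i * (x * poly (pderiv Q) x + (real i + 1) * poly Q x)"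
    unfolding higher_pderiv_quadratic_mult higher_pderiv_smult higher_pderiv_X_mult
    using p3
    by (simp add: p1[symmetric] p2[symmetric] Q_def[symmetric] algebra_simps power2_eq_square 
       del: funpow.simps)
  then have ode: "(1 - x\<^sup>2) * poly (pderiv (pderiv Q)) x
    = 2 * x * poly (pderiv Q) x - real i * (real i + 1) * poly Q x"
    by (simp add: algebra_simps)
  obtain c where "legendre i = Polynomial.smult c Q"
    by (simp add: legendre_def Q_def u_def)
  then show ?thesis
    using arg_cong[OF ode, of "\<lambda>t. c * t"]
    by (simp add: pderiv_smult algebra_simps)
qed

text \<open>The reflection leaves \<open>x^2 - 1\<close> fixed, and each of the \<open>i\<close>
  derivatives contributes a factor -1.\<close>

lemma legendre_minus: "poly (legendre i) (- x) = (- 1) ^ i * poly (legendre i) x"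
proof -
  have d: "(pderiv ^^ k) p \<circ>\<^sub>p [:0, -1:] = Polynomial.smult ((-1) ^ k) ((pderiv ^^ k) (p \<circ>\<^sub>p [:0, -1:]))"
    for k and p :: "real poly"
  proof (induction k)
    case (Suc k)
    have "pderiv ((pderiv ^^ k) p) \<circ>\<^sub>p [:0, -1:] = - pderiv ((pderiv ^^ k) p \<circ>\<^sub>p [:0, -1:])"
      by (simp add: pderiv_pcompose pderiv_pCons)
    then show ?case
      by (simp add: Suc pderiv_smult)
  qed simp
  have "legendre i \<circ>\<^sub>p [:0, -1:] = Polynomial.smult ((-1) ^ i) (legendre i)"
    unfolding legendre_def pcompose_smult d pcompose_hom.hom_power
    by (simp add: pcompose_pCons)
  then have "poly (legendre i \<circ>\<^sub>p [:0, -1:]) x = poly (Polynomial.smult ((-1) ^ i) (legendre i)) x"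
    by simp
  then show ?thesis by (simp add: poly_pcompose)
qed

(* P^2 + (1-x^2) P'^2 / (i (i+1)) is monotone on [0,1], by the differential equation. *)
lemma abs_legendre_le_1:
  assumes "\<bar>x\<bar> \<le> 1"
  shows "\<bar>poly (legendre i) x\<bar> \<le> 1"
proof (cases "i = 0")
  case True
  then show ?thesis by (simp add: legendre_def)
next
  case False
  define N where "N = real i * (real i + 1)"
  have N: "N > 0" using False by (simp add: N_def)
  define P where "P = poly (legendre i)"
  define P' where "P' = poly (pderiv (legendre i))"
  define P'' where "P'' = poly (pderiv (pderiv (legendre i)))"
  define S where "S t = (P t)\<^sup>2 + (1 - t\<^sup>2) * (P' t)\<^sup>2 / N" for t
  have ode: "(1 - t\<^sup>2) * P'' t = 2 * t * P' t - N * P t" for t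
    using legendre_ode[of t i] by (simp add: P_def P'_def P''_def N_def)
  have dP: "(P has_real_derivative P' t) (at t)" "(P' has_real_derivative P'' t) (at t)" for t
    unfolding P_def P'_def P''_def by (rule poly_DERIV)+
  have dS: "(S has_real_derivative 2 * t * (P' t)\<^sup>2 / N) (at t)" for t
  proof -
    have "(S has_real_derivative 2 * P t * P' t
        + ((0 - 2 * t) * (P' t)\<^sup>2 + 2 * P' t * P'' t * (1 - t\<^sup>2)) / N) (at t)"
      unfolding S_def using N by (auto intro!: derivative_eq_intros dP)
    moreover have "2 * P' t * P'' t * (1 - t\<^sup>2) = 2 * P' t * (2 * t * P' t - N * P t)"
      by (simp add: ode[symmetric])
    ultimately show ?thesis using N by (simp add: field_simps power2_eq_square)
  qed
  \<comment> \<open>The derivative of \<open>S\<close> has a sign on [0, 1] only, hence the detour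
    through the absolute value and parity. The second summand of \<open>S\<close> vanishes at 1, so
    \<open>S 1 = 1\<close>.\<close>
  have "S \<bar>x\<bar> \<le> S 1"
    using assms N dS by (intro DERIV_nonneg_imp_nondecreasing[of "\<bar>x\<bar>" 1 S]) (auto intro!: exI)
  then have "(P \<bar>x\<bar>)\<^sup>2 \<le> 1"
    using assms N power_le_one[of "\<bar>x\<bar>" 2] unfolding S_def
    by (simp add: P_def legendre_at_1)
      (smt (verit) divide_nonneg_pos mult_nonneg_nonneg zero_le_power2)
  then have "\<bar>P \<bar>x\<bar>\<bar> \<le> 1"
    by (simp add: abs_square_le_1)
  moreover have "\<bar>P \<bar>x\<bar>\<bar> = \<bar>P x\<bar>"
    by (cases "x \<ge> 0") (simp_all add: P_def legendre_minus abs_mult power_abs)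
  ultimately show ?thesis by (simp add: P_def)
qed

section \<open>Orthogonality and normalisation of the Legendre polynomials\<close>

definition poly_int :: "real poly \<Rightarrow> real" where
  "poly_int p = integral {- 1..1} (poly p)"

lemma poly_integrable: "poly (p :: real poly) integrable_on {a..b}"
  by (intro integrable_continuous_real continuous_on_poly continuous_on_id)

lemma poly_int_0 [simp]: "poly_int 0 = 0"
  unfolding poly_int_def poly_0[abs_def] by simp

lemma poly_int_add: "poly_int (p + q) = poly_int p + poly_int q"
  unfolding poly_int_def poly_add[abs_def] by (intro integral_add poly_integrable)

lemma poly_int_smult: "poly_int (Polynomial.smult c p) = c * poly_int p"
  unfolding poly_int_def poly_smult[abs_def] by simp

lemma poly_int_sum: "poly_int (sum f A) = (\<Sum>i\<in>A. poly_int (f i))"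
  by (induction A rule: infinite_finite_induct) (simp_all add: poly_int_add poly_int_0)

lemma poly_int_pderiv: "poly_int (pderiv p) = poly p 1 - poly p (- 1)"
  unfolding poly_int_def
  by (intro integral_unique fundamental_theorem_of_calculus)
    (auto simp flip: has_real_derivative_iff_has_vector_derivative
      intro: DERIV_subset poly_DERIV)

lemma poly_int_by_parts:
  assumes "poly w 1 = 0" "poly w (- 1) = 0"
  shows "poly_int (pderiv w * q) = - poly_int (w * pderiv q)"
  using poly_int_pderiv[of "w * q"] assms
  by (simp add: pderiv_mult poly_int_add mult.commute)

lemma power_dvd_higher_pderiv:
  fixes a :: "real poly"
  assumes "a ^ i dvd p" "k \<le> i"
  shows "a ^ (i - k) dvd (pderiv ^^ k) p"
  using \<open>k \<le> i\<close>
proof (induction k)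
  case 0
  then show ?case using assms by simp
next
  case (Suc k)
  then obtain q where "(pderiv ^^ k) p = a ^ (i - k) * q" by (auto simp: dvd_def)
  moreover have "i - k = Suc (i - Suc k)" using Suc.prems by simp
  ultimately have "pderiv ((pderiv ^^ k) p)
     = a ^ (i - Suc k) * (a * pderiv q + Polynomial.smult (of_nat (Suc (i - Suc k))) (pderiv a * q))"
    by (simp only: pderiv_mult pderiv_power_Suc) (simp add: algebra_simps)
  then show ?case by simp
qed

text \<open>The points 1 and -1 are zeros of order \<open>i\<close>, and each differentiation lowers
  the order by one. This removes the boundary terms in the integrations by parts that
  follow.\<close>

lemma rodrigues_boundary:
  assumes "k < i" "x\<^sup>2 = 1"
  shows "poly ((pderiv ^^ k) ([:- 1, 0, 1:] ^ i)) x = (0::real)"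
proof -
  have "[:- 1, 0, 1::real:] ^ (i - k) dvd (pderiv ^^ k) ([:- 1, 0, 1:] ^ i)"
    using assms by (intro power_dvd_higher_pderiv) auto
  then obtain q where "(pderiv ^^ k) ([:- 1, 0, 1::real:] ^ i) = [:- 1, 0, 1:] ^ (i - k) * q"
    by (rule dvdE)
  then show ?thesis using assms
    by (simp add: poly_power power2_eq_square zero_power)
qed

text \<open>Integration by parts, \<open>j\<close> times; the boundary terms only involve
  derivatives of order below \<open>i\<close>.\<close>

lemma poly_int_rodrigues:
  assumes "j \<le> i"
  shows "poly_int ((pderiv ^^ i) ([:- 1, 0, 1:] ^ i) * q)
    = (- 1) ^ j * poly_int ((pderiv ^^ (i - j)) ([:- 1, 0, 1:] ^ i) * (pderiv ^^ j) q)"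
  using assms
proof (induction j)
  case (Suc j)
  have e: "i - j = Suc (i - Suc j)" using Suc.prems by simp
  have "poly_int ((pderiv ^^ (i - j)) ([:- 1, 0, 1:] ^ i) * (pderiv ^^ j) q)
     = - poly_int ((pderiv ^^ (i - Suc j)) ([:- 1, 0, 1:] ^ i) * pderiv ((pderiv ^^ j) q))"
    unfolding e funpow.simps o_apply using Suc.prems
    by (intro poly_int_by_parts rodrigues_boundary) auto
  then show ?case using Suc by simp
qed simp

text \<open>For \<open>j = i\<close> in \<open>poly_int_rodrigues\<close> all derivatives fall on
  \<open>q\<close>, and its \<open>i\<close>-th derivative is zero.\<close>

lemma legendre_orth_lower_degree:
  assumes "Polynomial.degree q < i"
  shows "poly_int (legendre i * q) = 0"
proof -
  have "(pderiv ^^ i) q = 0"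
    using assms degree_higher_pderiv[of i q]
    by (intro poly_eqI) (simp add: coeff_higher_pderiv coeff_eq_0)
  then have "poly_int ((pderiv ^^ i) ([:- 1, 0, 1:] ^ i) * q) = 0"
    unfolding poly_int_rodrigues[OF order.refl, of i q] by simp
  then show ?thesis
    by (simp add: legendre_def poly_int_smult)
qed

lemma degree_legendre: "Polynomial.degree (legendre i) = i"
proof -
  have "Polynomial.degree ([:- 1, 0, 1::real:] ^ i) = 2 * i"
    by (simp add: degree_power_eq)
  then show ?thesis
    by (simp add: legendre_def degree_higher_pderiv)
qed

lemma legendre_orth: "i \<noteq> j \<Longrightarrow> poly_int (legendre i * legendre j) = 0"
  by (metis degree_legendre legendre_orth_lower_degree linorder_neqE_nat mult.commute)

text \<open>In \<open>r = x P' - i P\<close> the leading terms cancel, so \<open>r\<close> is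
  orthogonal to \<open>P\<close>. Integrating the derivative of \<open>x P^2\<close>, which equals
  \<open>2 P r + (2 i + 1) P^2\<close>, then gives the norm from boundary values alone.\<close>

lemma legendre_norm: "poly_int (legendre i * legendre i) = 2 / (2 * real i + 1)"
proof -
  define P where "P = legendre i"
  define r where "r = [:0, 1:] * pderiv P - Polynomial.smult (real i) P"
  have "poly_int (P * r) = 0"
  proof (cases "r = 0")
    case False
    have "coeff r k = (real k - real i) * coeff P k" for k
      by (cases k) (simp_all add: r_def coeff_pderiv algebra_simps)
    then have "coeff r k = 0" if "k \<ge> i" for k
      using that degree_legendre[of i] by (cases "k = i") (simp_all add: P_def coeff_eq_0)
    then have "Polynomial.degree r < i"
      using False by (metis leading_coeff_0_iff not_le_imp_less)
    then show ?thesis by (simp add: P_def legendre_orth_lower_degree)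
  qed simp
  moreover have "pderiv ([:0, 1:] * (P * P)) = Polynomial.smult 2 (P * r) + Polynomial.smult (2 * real i + 1) (P * P)"
    by (simp add: r_def pderiv_mult pderiv_pCons poly_eq_poly_eq_iff[symmetric] fun_eq_iff algebra_simps)
  moreover have "poly_int (pderiv ([:0, 1:] * (P * P))) = 2"
    unfolding poly_int_pderiv using legendre_minus[of i 1]
    by (simp add: P_def legendre_at_1 flip: power_mult_distrib power_add)
  ultimately have "(2 * real i + 1) * poly_int (P * P) = 2"
    by (simp add: poly_int_add poly_int_smult)
  then show ?thesis by (simp add: P_def field_simps)
qed

section \<open>Expansion in the rescaled Legendre polynomials\<close>

lemma legendre_span:
  assumes "Polynomial.degree p \<le> n"
  shows "\<exists>d. p = (\<Sum>i\<le>n. Polynomial.smult (d i) (legendre i))"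
  using assms
proof (induction n arbitrary: p)
  case 0
  then obtain a where "p = [:a:]" by (auto elim: degree_eq_zeroE)
  then show ?case by (intro exI[of _ "\<lambda>_. a"]) (simp add: legendre_def)
next
  case (Suc n)
  define a where "a = coeff p (Suc n) / coeff (legendre (Suc n)) (Suc n)"
  define q where "q = p - Polynomial.smult a (legendre (Suc n))"
  have "coeff (legendre (Suc n)) (Suc n) \<noteq> 0"
    using degree_legendre[of "Suc n"] by (metis degree_0 leading_coeff_neq_0 nat.distinct(1))
  then have "coeff q (Suc n) = 0"
    by (simp add: q_def a_def)
  moreover have "Polynomial.degree q \<le> Suc n"
    unfolding q_def using Suc.prems by (intro degree_diff_le) (simp_all add: degree_legendre)
  ultimately have "Polynomial.degree q \<le> n"
    by (metis le_SucE leading_coeff_0_iff degree_0 le0)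
  then obtain d where d: "q = (\<Sum>i\<le>n. Polynomial.smult (d i) (legendre i))"
    using Suc.IH by blast
  have "p = q + Polynomial.smult a (legendre (Suc n))" by (simp add: q_def)
  then show ?case
    by (intro exI[of _ "d(Suc n := a)"]) (simp add: d)
qed

text \<open>Parseval's identity after rescaling to [-1, 1]: the squared coefficients add up to the
  integral of \<open>p^2\<close> over an interval of length \<open>2 * \<gamma>\<close>. It turns a
  bound on [-\<gamma>, \<gamma>] into a bound on frame coefficients.\<close>

lemma psi_expansion:
  assumes "Polynomial.degree p \<le> n" "\<gamma> > 0" and M: "\<And>x. \<bar>x\<bar> \<le> \<gamma> \<Longrightarrow> \<bar>poly p x\<bar> \<le> M"
  obtains t where "\<And>x. poly p x = (\<Sum>i\<le>n. t i * psi \<gamma> i x)" "(\<Sum>i\<le>n. (t i)\<^sup>2) \<le> 2 * \<gamma> * M\<^sup>2"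
proof -
  define q where "q = p \<circ>\<^sub>p [:0, \<gamma>:]"
  have "Polynomial.degree q \<le> n"
    using assms(1,2) by (simp add: q_def)
  then obtain d where d: "q = (\<Sum>i\<le>n. Polynomial.smult (d i) (legendre i))"
    using legendre_span by blast
  define t where "t i = d i * sqrt \<gamma> / sqrt (real i + 1 / 2)" for i
  have td: "t i * psi \<gamma> i x = d i * poly (legendre i) (x / \<gamma>)" for i x
  proof -
    have "sqrt (real i + 1 / 2) \<noteq> 0" "sqrt \<gamma> \<noteq> 0" using assms by simp_all
    then show ?thesis by (simp add: t_def psi_def)
  qed
  show thesis
  proof
    show "poly p x = (\<Sum>i\<le>n. t i * psi \<gamma> i x)" for x
    proof -
      have "poly p x = poly q (x / \<gamma>)" using assms by (simp add: q_def poly_pcompose)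
      also have "\<dots> = (\<Sum>i\<le>n. d i * poly (legendre i) (x / \<gamma>))"
        by (simp add: d poly_sum)
      finally show ?thesis by (simp add: td)
    qed
    have "poly_int (q * q) = (\<Sum>i\<le>n. \<Sum>j\<le>n. d i * d j * poly_int (legendre i * legendre j))"
      by (simp add: d sum_product poly_int_sum poly_int_smult mult.assoc mult.left_commute)
    also have "\<dots> = (\<Sum>i\<le>n. \<Sum>j\<le>n. if i = j then (d i)\<^sup>2 * (2 / (2 * real i + 1)) else 0)"
      by (intro sum.cong refl) (auto simp: legendre_orth legendre_norm power2_eq_square)
    also have "\<dots> = (\<Sum>i\<le>n. (d i)\<^sup>2 * (2 / (2 * real i + 1)))"
      by simp
    finally have "\<gamma> * poly_int (q * q) = (\<Sum>i\<le>n. (t i)\<^sup>2)"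
      using assms(2) by (simp add: sum_distrib_left t_def power_mult_distrib power_divide field_simps)
    moreover have "poly_int (q * q) \<le> 2 * M\<^sup>2"
    proof -
      have "poly_int (q * q) \<le> integral {- 1..1::real} (\<lambda>_. M\<^sup>2)"
        unfolding poly_int_def
      proof (intro integral_le poly_integrable integrable_const_ivl)
        fix y :: real assume "y \<in> {- 1..1}"
        then have "\<bar>\<gamma> * y\<bar> \<le> \<gamma>" using assms by (simp add: abs_mult abs_le_iff)
        then have "\<bar>poly q y\<bar> \<le> M"
          using M by (simp add: q_def poly_pcompose mult.commute)
        then show "poly (q * q) y \<le> M\<^sup>2"
          using abs_le_square_iff[of "poly q y" M] by (simp add: power2_eq_square)
      qed
      then show ?thesis by simp
    qed
    ultimately show "(\<Sum>i\<le>n. (t i)\<^sup>2) \<le> 2 * \<gamma> * M\<^sup>2"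
      using assms(2) mult_left_mono[of "poly_int (q * q)" "2 * M\<^sup>2" \<gamma>] by simp
  qed
qed

section \<open>Growth of polynomials near an interval\<close>

text \<open>The two solutions \<open>w\<close> are the roots of \<open>w^2 - 2 v w + 1\<close>;
  their product is 1, so one of them has modulus at least 1.\<close>

lemma joukowski_surj:
  fixes v :: complex
  obtains w where "cmod w \<ge> 1" "v = (w + 1 / w) / 2"
proof -
  define a b where "a = v + csqrt (v\<^sup>2 - 1)" and "b = v - csqrt (v\<^sup>2 - 1)"
  have ab: "a * b = 1"
    by (simp add: a_def b_def algebra_simps flip: power2_eq_square)
  then have b: "b = 1 / a" "a = 1 / b"
    by (metis divide_self_if mult_zero_left mult_zero_right nonzero_eq_divide_eq zero_neq_one mult.commute)+
  have v: "v = (a + b) / 2" by (simp add: a_def b_def)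
  have "cmod a * cmod b = 1" using ab by (metis norm_mult norm_one)
  then have "\<not> (cmod a < 1 \<and> cmod b < 1)"
    using mult_strict_mono[of "cmod a" 1 "cmod b" 1] by auto
  then have "cmod a \<ge> 1 \<or> cmod b \<ge> 1" by linarith
  then show thesis
  proof
    assume "cmod a \<ge> 1"
    then show thesis using that[of a] v b(1) by simp
  next
    assume "cmod b \<ge> 1"
    then show thesis using that[of b] v b(2) by (simp add: add.commute)
  qed
qed

(* After the substitution u = 1/w the polynomial becomes u^-n times an entire function of u,
   and the circle |u| = 1 is mapped onto [-\<gamma>,\<gamma>]. *)
lemma bernstein_walsh:
  fixes p :: "complex poly" and \<gamma> :: real
  assumes deg: "Polynomial.degree p \<le> n" and g: "\<gamma> > 0"
    and M: "\<And>x::real. \<bar>x\<bar> \<le> \<gamma> \<Longrightarrow> cmod (poly p (of_real x)) \<le> M"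
    and w: "cmod w \<ge> 1"
  shows "cmod (poly p (of_real \<gamma> * ((w + 1 / w) / 2))) \<le> M * cmod w ^ n"
proof -
  define G where "G u = (\<Sum>i\<le>n. coeff p i * (of_real \<gamma> / 2) ^ i * (u\<^sup>2 + 1) ^ i * u ^ (n - i))" for u :: complex
  have G: "G u = u ^ n * poly p (of_real \<gamma> * ((u + 1 / u) / 2))" if "u \<noteq> 0" for u
  proof -
    have p: "poly p x = (\<Sum>i\<le>n. coeff p i * x ^ i)" for x
      unfolding poly_altdef using deg
      by (intro sum.mono_neutral_left) (auto simp: coeff_eq_0)
    have "coeff p i * (of_real \<gamma> / 2) ^ i * (u\<^sup>2 + 1) ^ i * u ^ (n - i)
        = u ^ n * (coeff p i * (of_real \<gamma> * ((u + 1 / u) / 2)) ^ i)" if "i \<le> n" for i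
    proof -
      have "u ^ n = u ^ (n - i) * u ^ i" using that by (simp flip: power_add)
      moreover have "u\<^sup>2 + 1 = u * (u + 1 / u)"
        using \<open>u \<noteq> 0\<close> by (simp add: distrib_left power2_eq_square)
      then have "(of_real \<gamma> / 2) * (u\<^sup>2 + 1) = u * (of_real \<gamma> * ((u + 1 / u) / 2))"
        by simp
      then have "((of_real \<gamma> / 2) * (u\<^sup>2 + 1)) ^ i = (u * (of_real \<gamma> * ((u + 1 / u) / 2))) ^ i"
        by (rule arg_cong)
      then have "(of_real \<gamma> / 2) ^ i * (u\<^sup>2 + 1) ^ i = u ^ i * (of_real \<gamma> * ((u + 1 / u) / 2)) ^ i"
        by (simp only: power_mult_distrib)
      ultimately show ?thesis by (simp only: mult_ac)
    qed
    then show ?thesis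
      unfolding G_def p sum_distrib_left by (intro sum.cong) auto
  qed
  have GM: "cmod (G (1 / w)) \<le> M"
  proof (rule maximum_modulus_frontier[of G "cball 0 1"])
    show "G holomorphic_on interior (cball 0 1)" "continuous_on (closure (cball 0 1)) G"
      unfolding G_def by (auto intro!: holomorphic_intros continuous_intros)
    show "1 / w \<in> cball 0 1"
      using w by (simp add: norm_divide divide_le_eq_1)
    fix z :: complex assume "z \<in> frontier (cball 0 1)"
    then have z: "cmod z = 1" by simp
    then have "z \<noteq> 0" by auto
    moreover have "(z + 1 / z) / 2 = of_real (Re z)"
      using z complex_div_cnj[of 1 z] by (simp add: complex_add_cnj)
    ultimately have "G z = z ^ n * poly p (of_real (\<gamma> * Re z))" by (simp add: G)
    moreover have "\<bar>\<gamma> * Re z\<bar> \<le> \<gamma>"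
      using abs_Re_le_cmod[of z] z g by (simp add: abs_mult)
    ultimately show "cmod (G z) \<le> M"
      using M[of "\<gamma> * Re z"] z by (simp add: norm_mult norm_power)
  qed simp
  have "w \<noteq> 0" using w by auto
  then have "poly p (of_real \<gamma> * ((w + 1 / w) / 2)) = w ^ n * G (1 / w)"
    by (simp add: G power_divide add.commute)
  then have "cmod (poly p (of_real \<gamma> * ((w + 1 / w) / 2))) = cmod w ^ n * cmod (G (1 / w))"
    by (simp only: norm_mult norm_power)
  with GM show ?thesis
    by (simp add: mult.commute[of M] mult_left_mono)
qed

text \<open>A point on the ellipse of parameter \<rho> around [-\<gamma>, \<gamma>] has distance at
  least \<open>sqrt (\<gamma>\<^sup>2 - 1) * S\<close> from [-1, 1], where
  \<open>S = sinh (ln \<rho>)\<close>, and sinh dominates the identity on nonnegative reals.\<close>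

lemma joukowski_dist:
  fixes y \<gamma> :: real
  assumes w: "cmod w \<ge> 1" and y: "\<bar>y\<bar> \<le> 1" and g: "\<gamma> > 1"
  shows "sqrt (\<gamma>\<^sup>2 - 1) * ln (cmod w) \<le> cmod (of_real \<gamma> * ((w + 1 / w) / 2) - of_real y)"
proof -
  define \<rho> where "\<rho> = cmod w"
  define a b where "a = Re w / \<rho>" and "b = Im w / \<rho>"
  define C S where "C = (\<rho> + 1 / \<rho>) / 2" and "S = (\<rho> - 1 / \<rho>) / 2"
  have \<rho>: "\<rho> \<ge> 1" using w by (simp add: \<rho>_def)
  have "(Re w)\<^sup>2 + (Im w)\<^sup>2 \<noteq> 0"
    using \<rho> unfolding cmod_power2[of w, symmetric] by (auto simp: \<rho>_def)
  then have ab: "a\<^sup>2 + b\<^sup>2 = 1"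
    using cmod_power2[of w] by (simp add: a_def b_def power_divide \<rho>_def flip: add_divide_distrib)
  have CS: "C\<^sup>2 - S\<^sup>2 = 1"
    using \<rho> by (simp add: C_def S_def power2_eq_square field_simps)
  have rw: "Re w = \<rho> * a" "Im w = \<rho> * b" using \<rho> by (simp_all add: a_def b_def)
  have inv: "Re (1 / w) = a / \<rho>" "Im (1 / w) = - b / \<rho>"
    using \<rho> by (simp_all add: Re_divide Im_divide flip: cmod_power2)
      (simp_all add: rw power2_eq_square flip: \<rho>_def)
  define z where "z = of_real \<gamma> * ((w + 1 / w) / 2)"
  have z: "Re z = \<gamma> * C * a" "Im z = \<gamma> * S * b"
    unfolding z_def Re_complex_of_real Im_complex_of_real complex.sel times_complex.sel inv rw C_def S_def
      Re_divide_numeral Im_divide_numeral plus_complex.sel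
    by (simp_all add: algebra_simps add_divide_distrib diff_divide_distrib)
  have "(cmod (z - of_real y))\<^sup>2 = (\<gamma> * C * a - y)\<^sup>2 + (\<gamma> * S * b)\<^sup>2"
    by (simp add: cmod_power2 z)
  also have "\<dots> = (\<gamma> * a - y * C)\<^sup>2 + (\<gamma>\<^sup>2 - y\<^sup>2) * S\<^sup>2"
  proof -
    have "C\<^sup>2 = 1 + S\<^sup>2" "b\<^sup>2 = 1 - a\<^sup>2" using ab CS by simp_all
    then show ?thesis
      unfolding power2_diff power_mult_distrib
      by (simp only: \<open>C\<^sup>2 = 1 + S\<^sup>2\<close> \<open>b\<^sup>2 = 1 - a\<^sup>2\<close>) (simp add: algebra_simps)
  qed
  also have "\<dots> \<ge> (\<gamma>\<^sup>2 - 1) * S\<^sup>2"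
  proof -
    have "(\<gamma>\<^sup>2 - 1) * S\<^sup>2 \<le> (\<gamma>\<^sup>2 - y\<^sup>2) * S\<^sup>2"
      using y by (intro mult_right_mono) (simp_all add: abs_square_le_1)
    then show ?thesis by (simp add: add_increasing)
  qed
  finally have "(sqrt (\<gamma>\<^sup>2 - 1) * S)\<^sup>2 \<le> (cmod (z - of_real y))\<^sup>2"
    using g by (simp add: power_mult_distrib one_le_power)
  then have "sqrt (\<gamma>\<^sup>2 - 1) * S \<le> cmod (z - of_real y)"
    by (rule power2_le_imp_le) simp
  moreover have "ln \<rho> \<le> S"
    using real_le_x_sinh[of "ln \<rho>"] sinh_ln_real[of \<rho>] \<rho> by (simp add: S_def inverse_eq_divide exp_minus)
  moreover have "sqrt (\<gamma>\<^sup>2 - 1) \<ge> 0" using g by (simp add: one_le_power)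
  ultimately show ?thesis
    unfolding z_def \<rho>_def by (meson mult_left_mono order_trans)
qed

text \<open>By \<open>joukowski_dist\<close> the disc lies inside the ellipse around
  [-\<gamma>, \<gamma>] whose parameter is the exponential of
  \<open>r / sqrt (\<gamma>\<^sup>2 - 1)\<close>; \<open>bernstein_walsh\<close> contributes the
  \<open>n\<close>-th power of that parameter.\<close>

lemma poly_growth_near_interval:
  fixes p :: "complex poly" and \<gamma> y r :: real
  assumes deg: "Polynomial.degree p \<le> n" and g: "\<gamma> > 1"
    and M: "\<And>x::real. \<bar>x\<bar> \<le> \<gamma> \<Longrightarrow> cmod (poly p (of_real x)) \<le> M"
    and y: "\<bar>y\<bar> \<le> 1" and z: "cmod (z - of_real y) \<le> r"
  shows "cmod (poly p z) \<le> M * exp (real n * r / sqrt (\<gamma>\<^sup>2 - 1))"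
proof -
  obtain w where w: "cmod w \<ge> 1" "z / of_real \<gamma> = (w + 1 / w) / 2"
    by (rule joukowski_surj)
  then have zw: "z = of_real \<gamma> * ((w + 1 / w) / 2)"
    using g by (simp add: field_simps)
  have s: "sqrt (\<gamma>\<^sup>2 - 1) > 0" using g by (simp add: one_less_power)
  have "sqrt (\<gamma>\<^sup>2 - 1) * ln (cmod w) \<le> r"
    using joukowski_dist[OF w(1) y g] z zw by simp
  then have "ln (cmod w) \<le> r / sqrt (\<gamma>\<^sup>2 - 1)" using s by (simp add: field_simps)
  then have "exp (ln (cmod w)) ^ n \<le> exp (r / sqrt (\<gamma>\<^sup>2 - 1)) ^ n"
    by (intro power_mono) simp_all
  moreover have "exp (ln (cmod w)) = cmod w" using w(1) by (intro exp_ln) linarith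
  ultimately have "cmod w ^ n \<le> exp (real n * r / sqrt (\<gamma>\<^sup>2 - 1))"
    by (simp add: exp_of_nat_mult[symmetric])
  moreover have "M \<ge> 0" using order_trans[OF norm_ge_zero M[of 0]] g by simp
  moreover have "cmod (poly p z) \<le> M * cmod w ^ n"
    unfolding zw using g by (intro bernstein_walsh deg M w(1)) auto
  ultimately show ?thesis by (meson mult_left_mono order_trans)
qed

section \<open>Cauchy estimates and truncated Taylor expansions\<close>

lemma cauchy_coeff_bound:
  fixes P :: "complex poly"
  assumes "R > 0" and B: "\<And>z. cmod z = R \<Longrightarrow> cmod (poly P z) \<le> B"
  shows "cmod (coeff P j) \<le> B / R ^ j"
proof -
  have d: "(deriv ^^ j) (poly P) = poly ((pderiv ^^ j) P)"
  proof (induction j)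
    case (Suc j)
    then show ?case by (auto intro!: ext DERIV_imp_deriv poly_DERIV)
  qed simp
  have "cmod ((deriv ^^ j) (poly P) 0) \<le> fact j * B / R ^ j"
    using assms by (intro Cauchy_inequality) (auto intro!: holomorphic_intros continuous_intros)
  also have "(deriv ^^ j) (poly P) 0 = fact j * coeff P j"
    by (simp add: d poly_0_coeff_0 coeff_higher_pderiv pochhammer_fact)
  finally have "fact j * cmod (coeff P j) \<le> fact j * (B / R ^ j)"
    by (simp add: norm_mult)
  then show ?thesis by (simp only: mult_le_cancel_left_pos fact_gt_zero)
qed

text \<open>Cauchy's estimate on the circle of radius e makes the \<open>i\<close>-th coefficient at
  most \<open>B / exp 1 ^ i\<close>, and the geometric tail beyond \<open>k\<close> sums to at most
  \<open>B * exp (- real k)\<close>. \<open>poly_cutoff (Suc k)\<close> keeps the degrees up to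
  \<open>k\<close>.\<close>

lemma taylor_tail_bound:
  fixes P :: "complex poly"
  assumes B: "\<And>z. cmod z \<le> exp 1 \<Longrightarrow> cmod (poly P z) \<le> B" and z: "cmod z \<le> 1"
  shows "cmod (poly P z - poly (poly_cutoff (Suc k) P) z) \<le> B * exp (- real k)"
proof -
  define N where "N = Polynomial.degree P"
  have B0: "B \<ge> 0" using order_trans[OF norm_ge_zero B[of 0]] by simp
  have "poly P z = (\<Sum>i\<le>N + Suc k. coeff P i * z ^ i)"
    unfolding poly_altdef N_def by (intro sum.mono_neutral_left) (auto simp: coeff_eq_0)
  moreover have "Polynomial.degree (poly_cutoff (Suc k) P) \<le> k"
    by (intro degree_le) (auto simp: coeff_poly_cutoff)
  then have "poly (poly_cutoff (Suc k) P) z = (\<Sum>i\<le>N + Suc k. coeff (poly_cutoff (Suc k) P) i * z ^ i)"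
    unfolding poly_altdef by (intro sum.mono_neutral_left) (auto simp: coeff_eq_0)
  ultimately have "poly P z - poly (poly_cutoff (Suc k) P) z
      = (\<Sum>i\<le>N + Suc k. coeff P i * z ^ i - coeff (poly_cutoff (Suc k) P) i * z ^ i)"
    by (simp only: sum_subtractf)
  also have "\<dots> = (\<Sum>i\<in>{k<..N + Suc k}. coeff P i * z ^ i)"
    by (intro sum.mono_neutral_cong_right) (auto simp: coeff_poly_cutoff)
  finally have "cmod (poly P z - poly (poly_cutoff (Suc k) P) z) \<le> (\<Sum>i\<in>{k<..N + Suc k}. B / exp 1 ^ i)"
  proof (elim ssubst, intro sum_norm_le)
    fix i
    have "cmod (coeff P i) * cmod z ^ i \<le> B / exp 1 ^ i * 1"
      using z by (intro mult_mono cauchy_coeff_bound B power_le_one) (auto simp: B0)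
    then show "cmod (coeff P i * z ^ i) \<le> B / exp 1 ^ i" by (simp add: norm_mult norm_power)
  qed
  also have "\<dots> \<le> B * exp (- real k)"
  proof -
    \<comment> \<open>The subtracted term makes the induction close: a new summand is absorbed by
      the change of that term, because 2 \<le> e.\<close>
    have "(\<Sum>i\<in>{k<..k + l}. B / exp 1 ^ i) \<le> B * exp (- real k) - B * exp (- real (k + l))" for l
    proof (induction l)
      case (Suc l)
      have "{k<..k + Suc l} = insert (k + Suc l) {k<..k + l}" by auto
      moreover have "B / exp 1 ^ (k + Suc l) = B * exp (- real (k + Suc l))"
        using exp_of_nat_mult[of "k + Suc l" "1::real"] by (simp only: exp_minus divide_inverse mult_1_right)
      moreover have "2 * (B * exp (- real (k + Suc l))) \<le> B * exp (- real (k + l))"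
      proof -
        have "exp (- real (k + l)) = exp 1 * exp (- real (k + Suc l))"
          by (simp flip: exp_add)
        moreover have "(2::real) \<le> exp 1" using exp_ge_add_one_self[of 1] by simp
        then have "2 * exp (- real (k + Suc l)) \<le> exp 1 * exp (- real (k + Suc l))"
          by (intro mult_right_mono) auto
        ultimately have "2 * exp (- real (k + Suc l)) \<le> exp (- real (k + l))" by simp
        from mult_left_mono[OF this B0] show ?thesis by (simp only: mult.left_commute)
      qed
      ultimately show ?case using Suc by simp
    qed simp
    from this[of "Suc N"] have "(\<Sum>i\<in>{k<..k + Suc N}. B / exp 1 ^ i)
        \<le> B * exp (- real k) - B * exp (- real (k + Suc N))" .
    moreover have "B * exp (- real (k + Suc N)) \<ge> 0" using B0 by simp
    moreover have "N + Suc k = k + Suc N" by simp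
    ultimately show ?thesis by (simp only:)
  qed
  finally show ?thesis .
qed

section \<open>Equispaced samples of polynomials of moderate growth\<close>

text \<open>Division by \<open>a\<close> brings \<open>q\<close> into the unit ball over which
  \<open>CR_B\<close> is a supremum. As \<open>sup_norm\<close> is a real supremum, passing from it
  to a point value requires boundedness, which compactness provides.\<close>

lemma CR_constant_poly_bound:
  fixes q :: "complex poly"
  assumes CR: "CR_constant \<beta>" and k: "1 \<le> k" "k \<le> M" and deg: "Polynomial.degree q \<le> k"
    and a: "a > 0" and grid: "\<And>i. i \<le> M \<Longrightarrow> cmod (poly q (of_real (grid_pt M i))) \<le> a"
    and x: "\<bar>x\<bar> \<le> 1"
  shows "cmod (poly q (of_real x)) \<le> a * \<beta> powr ((real k)\<^sup>2 / real M)"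
proof -
  define r where "r = Polynomial.smult (1 / of_real a) q"
  have r: "cmod (poly r z) = cmod (poly q z) / a" for z
    using a by (simp add: r_def norm_divide)
  have "grid_norm M (restrict_real (poly r)) \<le> 1"
    using grid a by (auto simp: grid_norm_def restrict_real_def r)
  moreover have "Polynomial.degree r \<le> k"
    using deg unfolding r_def by (meson degree_smult_le order_trans)
  ultimately have "ereal (sup_norm {-1..1} (restrict_real (poly r))) \<le> CR_B M k"
    unfolding CR_B_def by (intro SUP_upper) auto
  also have "\<dots> \<le> ereal (\<beta> powr ((real k)\<^sup>2 / real M))"
    using CR k by (simp add: CR_constant_def)
  finally have "sup_norm {-1..1} (restrict_real (poly r)) \<le> \<beta> powr ((real k)\<^sup>2 / real M)"
    by simp
  moreover have "cmod (poly r (of_real x)) \<le> sup_norm {-1..1} (restrict_real (poly r))"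
    unfolding sup_norm_def restrict_real_def
  proof (rule cSUP_upper)
    have "compact ((\<lambda>x. cmod (poly r (of_real x))) ` {-1..1::real})"
      by (intro compact_continuous_image continuous_intros) auto
    then show "bdd_above ((\<lambda>x. cmod (poly r (of_real x))) ` {-1..1::real})"
      by (intro bounded_imp_bdd_above compact_imp_bounded)
  qed (use x in auto)
  ultimately have "cmod (poly q (of_real x)) / a \<le> \<beta> powr ((real k)\<^sup>2 / real M)"
    unfolding r by linarith
  then show ?thesis
    using a by (simp add: divide_le_eq mult.commute)
qed

text \<open>The central estimate. Around \<open>x\<close> a window of \<open>M = k\<^sup>2\<close>
  grid intervals is rescaled to [-1, 1]. There \<open>p\<close> is within 1 of a polynomial
  \<open>q\<close> of degree at most \<open>k\<close>, so \<open>q\<close> is at most 2 on the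
  window's grid, at most \<open>2 * \<beta>\<close> throughout, and \<open>p\<close> gains 1
  more.\<close>

lemma poly_bound_from_grid:
  fixes p :: "complex poly" and \<beta> \<epsilon> \<gamma> :: real
  assumes CR: "CR_constant \<beta>" and eps: "0 < \<epsilon>" "\<epsilon> \<le> 1 / exp 1" and g: "\<gamma> > 1"
    and n: "real n \<ge> sqrt (\<gamma>\<^sup>2 - 1) * ln (1 / \<epsilon>)"
    and m: "real m \<ge> 36 * real n * ln (1 / \<epsilon>) / sqrt (\<gamma>\<^sup>2 - 1)"
    and deg: "Polynomial.degree p \<le> n"
    and grid: "\<And>i. i \<le> m \<Longrightarrow> cmod (poly p (of_real (grid_pt m i))) \<le> 1"
    and outer: "\<And>x. \<bar>x\<bar> \<le> \<gamma> \<Longrightarrow> cmod (poly p (of_real x)) \<le> 1 / \<epsilon>"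
    and x: "\<bar>x\<bar> \<le> 1"
  shows "cmod (poly p (of_real x)) \<le> 2 * \<beta> + 1"
proof -
  define L where "L = ln (1 / \<epsilon>)"
  define s where "s = sqrt (\<gamma>\<^sup>2 - 1)"
  \<comment> \<open>The upper bound \<open>k \<le> 6 L\<close> makes \<open>k\<^sup>2\<close>
    intervals fit into the grid; the lower bound makes the factor exp(-k) outweigh both
    \<open>1 / \<epsilon>\<close> and the growth of \<open>p\<close> near the window.\<close>
  define k where "k = nat \<lfloor>6 * L\<rfloor>"
  have s: "s > 0" using g by (simp add: s_def one_less_power)
  have "exp 1 \<le> 1 / \<epsilon>" using eps by (simp add: field_simps)
  then have "ln (exp 1) \<le> L" unfolding L_def using eps by (subst ln_le_cancel_iff) auto
  then have L: "L \<ge> 1" by simp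
  have k6: "real k \<le> 6 * L" "6 * L < real k + 1" using L unfolding k_def by linarith+
  then have k1: "k \<ge> 5" using L by linarith
  have "36 * L\<^sup>2 \<le> 36 * real n * L / s"
  proof -
    have "s * L * (36 * L) \<le> real n * (36 * L)"
      using n L by (intro mult_right_mono) (simp_all add: L_def s_def)
    then show ?thesis using s by (simp add: le_divide_eq power2_eq_square mult_ac)
  qed
  moreover have "(real k)\<^sup>2 \<le> (6 * L)\<^sup>2" using k6 by (intro power_mono) auto
  ultimately have "(real k)\<^sup>2 \<le> real m"
  proof -
    have "(6 * L)\<^sup>2 = 36 * L\<^sup>2" by (simp add: power_mult_distrib)
    moreover assume "36 * L\<^sup>2 \<le> 36 * real n * L / s" "(real k)\<^sup>2 \<le> (6 * L)\<^sup>2"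
    ultimately show ?thesis using m unfolding L_def[symmetric] s_def[symmetric] by linarith
  qed
  then have km: "k\<^sup>2 \<le> m" by (simp only: flip: of_nat_power of_nat_le_iff)
  have "0 < k\<^sup>2" using k1 by simp
  then have m0: "m > 0" using km by linarith
  define M where "M = k\<^sup>2"
  \<comment> \<open>The window consists of the grid points with indices \<open>j\<close> to
    \<open>j + M\<close>. The minimum shifts it back inside the grid when \<open>x\<close> is close
    to 1. Its midpoint is \<open>y\<close> and its half length \<open>h\<close>.\<close>
  define j where "j = min (nat \<lfloor>(x + 1) * real m / 2\<rfloor>) (m - M)"
  define h where "h = real M / real m"
  define y where "y = - 1 + (2 * real j + real M) / real m"
  have kM: "k \<le> M" by (simp add: M_def power2_eq_square)
  have M0: "M > 0" using kM k1 by simp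
  have jM: "j + M \<le> m" using km by (simp add: j_def M_def)
  have h0: "h > 0" using M0 m0 by (simp add: h_def)
  have y1: "\<bar>y\<bar> \<le> 1"
  proof -
    have "2 * real j + real M \<le> 2 * real m" using jM by linarith
    then show ?thesis using m0 by (simp add: y_def abs_le_iff field_simps)
  qed
  have xm: "0 \<le> (x + 1) * real m / 2" "(x + 1) * real m / 2 \<le> real m"
    using x m0 mult_right_mono[of "x + 1" 2 "real m"] by (simp_all add: abs_le_iff)
  have "real j \<le> (x + 1) * real m / 2"
    using xm unfolding j_def by linarith
  moreover have "(x + 1) * real m / 2 \<le> real j + real M"
    using xm M0 km unfolding j_def M_def[symmetric] by linarith
  moreover have "(y + 1) * real m = 2 * real j + real M"
    using m0 by (simp add: y_def)
  moreover have "(x - y) * real m = (x + 1) * real m - (y + 1) * real m"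
    by (simp add: algebra_simps)
  ultimately have "\<bar>(x - y) * real m\<bar> \<le> real M"
    by linarith
  then have "\<bar>x - y\<bar> * real m \<le> real M" by (simp only: abs_mult abs_of_nat)
  then have xy: "\<bar>x - y\<bar> \<le> h" using m0 by (simp add: h_def le_divide_eq)
  define \<xi> where "\<xi> = (x - y) / h"
  have \<xi>: "\<bar>\<xi>\<bar> \<le> 1" "x = y + h * \<xi>" using xy h0 by (simp_all add: \<xi>_def)
  define P where "P = p \<circ>\<^sub>p [:of_real y, of_real h:]"
  have P: "poly P z = poly p (of_real y + of_real h * z)" for z
    by (simp add: P_def poly_pcompose mult.commute)
  define B where "B = 1 / \<epsilon> * exp (real n * (h * exp 1) / s)"
  have PB: "cmod (poly P z) \<le> B" if "cmod z \<le> exp 1" for z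
    unfolding P B_def s_def using that h0
    by (intro poly_growth_near_interval[OF deg g outer y1]) (auto simp: norm_mult)
  define q where "q = poly_cutoff (Suc k) P"
  have "B * exp (- real k) \<le> 1"
  proof -
    \<comment> \<open>Since \<open>m * h = k\<^sup>2\<close>, the lower bound on \<open>m\<close>
      yields \<open>36 L (n h / s) \<le> k\<^sup>2\<close>, and \<open>6 L\<close> is at least
      \<open>k\<close>.\<close>
    have "real n * h / s \<le> real k / 6"
    proof -
      have "36 * real n * L / s * (real n * h / s) \<le> real m * (real n * h / s)"
        using m h0 s by (intro mult_right_mono) (auto simp: L_def s_def)
      also have "\<dots> = real n / s * (real k)\<^sup>2" using m0 by (simp add: h_def M_def)
      finally have "(real n / s) * (36 * L * (real n * h / s)) \<le> (real n / s) * (real k)\<^sup>2"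
        by (simp add: mult_ac)
      moreover have "s * L > 0" using s L by simp
      then have "real n > 0" using n unfolding L_def[symmetric] s_def[symmetric] by linarith
      then have "real n / s > 0" using s by simp
      ultimately have "36 * L * (real n * h / s) \<le> (real k)\<^sup>2"
        by (simp only: mult_le_cancel_left_pos)
      moreover have "6 * real k * (real n * h / s) \<le> 36 * L * (real n * h / s)"
        using k6 s h0 by (intro mult_right_mono) auto
      ultimately have "real k * (6 * (real n * h / s)) \<le> real k * real k"
        by (simp add: power2_eq_square mult_ac)
      then have "6 * (real n * h / s) \<le> real k"
        by (rule mult_left_le_imp_le) (use k1 in simp)
      then show ?thesis by linarith
    qed
    \<comment> \<open>With e \<le> 3 the growth exponent is at most \<open>k / 2\<close>, and the
      other half of \<open>k\<close> exceeds \<open>L\<close>.\<close>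
    then have "real n * h / s * exp 1 \<le> real k / 6 * 3"
      using exp_le s h0 by (intro mult_mono) auto
    then have "L + real n * (h * exp 1) / s - real k \<le> 0"
      using k6 k1 by (simp add: mult_ac)
    then have "exp (L + real n * (h * exp 1) / s - real k) \<le> 1" by simp
    moreover have "1 / \<epsilon> = exp L" using eps by (simp add: L_def)
    ultimately show ?thesis by (simp add: B_def exp_add exp_diff exp_minus divide_inverse)
  qed
  then have Pq: "cmod (poly P z - poly q z) \<le> 1" if "cmod z \<le> 1" for z
    using taylor_tail_bound[OF PB that, of k] by (simp add: q_def)
  have "cmod (poly q (of_real \<xi>)) \<le> 2 * \<beta> powr ((real k)\<^sup>2 / real M)"
  proof (rule CR_constant_poly_bound[OF CR _ kM])
    show "1 \<le> k" using k1 by simp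
    show "Polynomial.degree q \<le> k"
      by (intro degree_le) (auto simp: q_def coeff_poly_cutoff)
    fix i assume i: "i \<le> M"
    \<comment> \<open>The rescaling maps the grid with \<open>M\<close> intervals onto the window's
      points of the original grid.\<close>
    have "y + h * grid_pt M i = grid_pt m (j + i)"
      using M0 m0 by (simp add: y_def h_def grid_pt_def field_simps)
    then have "cmod (poly P (of_real (grid_pt M i))) \<le> 1"
      using grid[of "j + i"] i jM by (simp add: P flip: of_real_mult of_real_add)
    moreover have "\<bar>grid_pt M i\<bar> \<le> 1"
      using i M0 by (simp add: grid_pt_def abs_le_iff field_simps)
    then have "cmod (poly P (of_real (grid_pt M i)) - poly q (of_real (grid_pt M i))) \<le> 1"
      by (intro Pq) simp
    ultimately show "cmod (poly q (of_real (grid_pt M i))) \<le> 2"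
      by norm
  qed (use \<xi> in auto)
  \<comment> \<open>The window was given \<open>k\<^sup>2\<close> intervals so that this exponent is
    exactly 1.\<close>
  moreover have "\<beta> powr ((real k)\<^sup>2 / real M) = \<beta>"
    using CR k1 by (simp add: M_def CR_constant_def)
  moreover have "cmod (poly P (of_real \<xi>) - poly q (of_real \<xi>)) \<le> 1"
    using \<xi> by (intro Pq) simp
  moreover have "poly p (of_real x) = poly P (of_real \<xi>)"
    using \<xi> by (simp add: P)
  ultimately show ?thesis
    using norm_triangle_sub[of "poly P (of_real \<xi>)" "poly q (of_real \<xi>)"] by simp
qed

text \<open>Homogeneity reduces this to \<open>K = 1\<close>; for \<open>K = 0\<close> the bound on
  [-\<gamma>, \<gamma>] already makes \<open>p\<close> vanish at \<open>x\<close>.\<close>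

lemma poly_bound_from_grid_scaled:
  fixes p :: "complex poly" and \<beta> \<epsilon> \<gamma> K :: real
  assumes CR: "CR_constant \<beta>" and eps: "0 < \<epsilon>" "\<epsilon> \<le> 1 / exp 1" and g: "\<gamma> > 1"
    and n: "real n \<ge> sqrt (\<gamma>\<^sup>2 - 1) * ln (1 / \<epsilon>)"
    and m: "real m \<ge> 36 * real n * ln (1 / \<epsilon>) / sqrt (\<gamma>\<^sup>2 - 1)"
    and deg: "Polynomial.degree p \<le> n"
    and K: "K \<ge> 0"
    and grid: "\<And>i. i \<le> m \<Longrightarrow> cmod (poly p (of_real (grid_pt m i))) \<le> K"
    and outer: "\<And>x. \<bar>x\<bar> \<le> \<gamma> \<Longrightarrow> cmod (poly p (of_real x)) \<le> K / \<epsilon>"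
    and x: "\<bar>x\<bar> \<le> 1"
  shows "cmod (poly p (of_real x)) \<le> (2 * \<beta> + 1) * K"
proof (cases "K = 0")
  case True
  then show ?thesis using outer[of x] x g by simp
next
  case False
  then have K: "K > 0" using K by simp
  define q where "q = Polynomial.smult (of_real (1 / K)) p"
  have q: "cmod (poly q z) = cmod (poly p z) / K" for z
    using K by (simp add: q_def norm_divide)
  have "cmod (poly q (of_real x)) \<le> 2 * \<beta> + 1"
  proof (rule poly_bound_from_grid[OF CR eps g n m _ _ _ x])
    show "Polynomial.degree q \<le> n"
      using deg unfolding q_def by (meson degree_smult_le order_trans)
  qed (use grid outer K in \<open>auto simp: q divide_le_eq\<close>)
  then show ?thesis using K by (simp add: q divide_le_eq)
qed

section \<open>Truncated singular value decompositions\<close>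

definition sqn :: "complex Matrix.vec \<Rightarrow> real" where
  "sqn v = (\<Sum>i<dim_vec v. (cmod (vec_index v i))\<^sup>2)"

text \<open>The vectors may differ in length, because the diagonal factor of the decomposition is
  rectangular: surplus entries of \<open>v\<close> have to vanish, and surplus entries of
  \<open>w\<close> only enlarge the right side.\<close>

lemma sqn_le:
  assumes "\<And>i. i < dim_vec v \<Longrightarrow>
      vec_index v i = 0 \<or> i < dim_vec w \<and> cmod (vec_index v i) \<le> K * cmod (vec_index w i)"
  shows "sqn v \<le> K\<^sup>2 * sqn w"
proof -
  have "sqn v = (\<Sum>i<max (dim_vec v) (dim_vec w). if i < dim_vec v then (cmod (vec_index v i))\<^sup>2 else 0)"
    unfolding sqn_def by (intro sum.mono_neutral_cong_left) auto
  also have "\<dots> \<le> (\<Sum>i<max (dim_vec v) (dim_vec w). if i < dim_vec w then K\<^sup>2 * (cmod (vec_index w i))\<^sup>2 else 0)"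
  proof (intro sum_mono)
    fix i
    have "(cmod (vec_index v i))\<^sup>2 \<le> K\<^sup>2 * (cmod (vec_index w i))\<^sup>2"
      if "cmod (vec_index v i) \<le> K * cmod (vec_index w i)"
      using power_mono[OF that, of 2] by (simp add: power_mult_distrib)
    then show "(if i < dim_vec v then (cmod (vec_index v i))\<^sup>2 else 0)
        \<le> (if i < dim_vec w then K\<^sup>2 * (cmod (vec_index w i))\<^sup>2 else 0)"
      using assms[of i] by auto
  qed
  also have "\<dots> = K\<^sup>2 * sqn w"
    unfolding sqn_def sum_distrib_left by (intro sum.mono_neutral_cong_right) auto
  finally show ?thesis .
qed

lemma mat_adjoint_carrier: "A \<in> carrier_mat r c \<Longrightarrow> mat_adjoint A \<in> carrier_mat c r"
  by (auto simp: mat_adjoint_def)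

lemma mat_adjoint_index:
  assumes "A \<in> carrier_mat r c" "i < c" "j < r"
  shows "mat_adjoint A $$ (i, j) = cnj (A $$ (j, i))"
  using assms by (auto simp: mat_adjoint_def mat_of_rows_def)

lemma mat_vec_index:
  assumes "A \<in> carrier_mat r c" "v \<in> carrier_vec c" "i < r"
  shows "vec_index (A *\<^sub>v v) i = (\<Sum>j<c. A $$ (i, j) * vec_index v j)"
  using assms by (auto simp: scalar_prod_def lessThan_atLeast0 intro!: sum.cong)

text \<open>In coordinates, the inner product of \<open>W v\<close> with itself equals that of the
  adjoint of \<open>W\<close> applied to \<open>W v\<close> with \<open>v\<close>.\<close>

lemma sqn_isometry:
  assumes W: "W \<in> carrier_mat k k" "mat_adjoint W * W = 1\<^sub>m k" and v: "v \<in> carrier_vec k"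
  shows "sqn (W *\<^sub>v v) = sqn v"
proof -
  define u where "u = W *\<^sub>v v"
  have u: "u \<in> carrier_vec k" using W v by (simp add: u_def)
  have s: "complex_of_real (sqn w) = (\<Sum>i<k. vec_index w i * cnj (vec_index w i))"
    if "w \<in> carrier_vec k" for w
    using that by (auto simp: sqn_def complex_norm_square[symmetric])
  have "mat_adjoint W *\<^sub>v u = v"
    unfolding u_def using W v mat_adjoint_carrier[OF W(1)]
    by (subst assoc_mult_mat_vec[symmetric, of _ k k _ k]) auto
  then have v': "vec_index v j = (\<Sum>i<k. cnj (W $$ (i, j)) * vec_index u i)" if "j < k" for j
    using mat_vec_index[OF mat_adjoint_carrier[OF W(1)] u that] W that by (simp add: mat_adjoint_index)
  have "complex_of_real (sqn u) = (\<Sum>i<k. \<Sum>j<k. W $$ (i, j) * vec_index v j * cnj (vec_index u i))"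
    unfolding s[OF u]
  proof (rule sum.cong[OF refl])
    fix i assume "i \<in> {..<k}"
    then have "vec_index u i = (\<Sum>j<k. W $$ (i, j) * vec_index v j)"
      using mat_vec_index[OF W(1) v] by (simp add: u_def)
    from arg_cong[OF this, of "\<lambda>t. t * cnj (vec_index u i)"]
    show "vec_index u i * cnj (vec_index u i) = (\<Sum>j<k. W $$ (i, j) * vec_index v j * cnj (vec_index u i))"
      by (simp only: sum_distrib_right)
  qed
  also have "\<dots> = (\<Sum>j<k. \<Sum>i<k. W $$ (i, j) * vec_index v j * cnj (vec_index u i))"
    by (rule sum.swap)
  also have "\<dots> = (\<Sum>j<k. vec_index v j * cnj (vec_index v j))"
  proof (rule sum.cong[OF refl])
    fix j assume "j \<in> {..<k}"
    then have "cnj (vec_index v j) = (\<Sum>i<k. W $$ (i, j) * cnj (vec_index u i))"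
      by (simp add: v')
    then show "(\<Sum>i<k. W $$ (i, j) * vec_index v j * cnj (vec_index u i)) = vec_index v j * cnj (vec_index v j)"
      by (simp add: sum_distrib_left mult_ac)
  qed
  also have "\<dots> = complex_of_real (sqn v)" by (simp add: s v)
  finally show ?thesis by (simp add: u_def)
qed

lemma mat_adjoint_adjoint: "mat_adjoint (mat_adjoint A) = (A :: complex mat)"
proof (rule eq_matI)
  have c: "A \<in> carrier_mat (dim_row A) (dim_col A)" by simp
  from c have c': "mat_adjoint A \<in> carrier_mat (dim_col A) (dim_row A)" by (rule mat_adjoint_carrier)
  show "dim_row (mat_adjoint (mat_adjoint A)) = dim_row A"
    "dim_col (mat_adjoint (mat_adjoint A)) = dim_col A"
    using carrier_matD[OF mat_adjoint_carrier[OF c']] by blast+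
  fix i j assume "i < dim_row A" "j < dim_col A"
  then show "mat_adjoint (mat_adjoint A) $$ (i, j) = A $$ (i, j)"
    using mat_adjoint_index[OF c'] mat_adjoint_index[OF c] by simp
qed

lemma sqn_unitary:
  assumes "unitary_mat W k" "v \<in> carrier_vec k"
  shows "sqn (W *\<^sub>v v) = sqn v" "sqn (mat_adjoint W *\<^sub>v v) = sqn v"
  using assms by (auto simp: unitary_mat_def mat_adjoint_adjoint mat_adjoint_carrier intro!: sqn_isometry)

lemma diagonal_mat_vec_index:
  assumes D: "D \<in> carrier_mat r c" "diagonal_mat D" and e: "e \<in> carrier_vec c" and i: "i < r"
  shows "vec_index (D *\<^sub>v e) i = (if i < c then D $$ (i, i) * vec_index e i else 0)"
proof -
  have "(\<Sum>j<c. D $$ (i, j) * vec_index e j) = (\<Sum>j<c. if j = i then D $$ (i, i) * vec_index e i else 0)"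
    using D i by (intro sum.cong) (auto simp: diagonal_mat_def)
  then show ?thesis
    using mat_vec_index[OF D(1) e i] by simp
qed

section \<open>The truncated pseudoinverse in singular coordinates\<close>

context
  fixes A U S V :: "complex mat" and r c :: nat and \<epsilon> :: real
  assumes svd: "is_svd A U S V" and A: "A \<in> carrier_mat r c" and eps: "\<epsilon> > 0"
begin

lemma svd_carriers:
  "U \<in> carrier_mat r r" "V \<in> carrier_mat c c" "S \<in> carrier_mat r c"
  "trunc_pinv \<epsilon> S \<in> carrier_mat c r"
  "mat_adjoint U \<in> carrier_mat r r" "mat_adjoint V \<in> carrier_mat c c"
  "unitary_mat U r" "unitary_mat V c" "A = U * S * mat_adjoint V"
  using svd A by (auto simp: is_svd_def unitary_mat_def trunc_pinv_def mat_adjoint_carrier)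

lemma unitary_cancel:
  "v \<in> carrier_vec r \<Longrightarrow> mat_adjoint U *\<^sub>v (U *\<^sub>v v) = v"
  "w \<in> carrier_vec c \<Longrightarrow> mat_adjoint V *\<^sub>v (V *\<^sub>v w) = w"
  "w \<in> carrier_vec c \<Longrightarrow> V *\<^sub>v (mat_adjoint V *\<^sub>v w) = w"
  using svd_carriers assoc_mult_mat_vec[of "mat_adjoint U" r r U r v]
    assoc_mult_mat_vec[of "mat_adjoint V" c c V c w] assoc_mult_mat_vec[of V c c "mat_adjoint V" c w]
  by (auto simp: unitary_mat_def)

lemma svd_apply:
  assumes "v \<in> carrier_vec c"
  shows "A *\<^sub>v v = U *\<^sub>v (S *\<^sub>v (mat_adjoint V *\<^sub>v v))"
proof -
  have "mat_adjoint V *\<^sub>v v \<in> carrier_vec c"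
    using svd_carriers(6) assms by (rule mult_mat_vec_carrier)
  then have "U * S *\<^sub>v (mat_adjoint V *\<^sub>v v) = U *\<^sub>v (S *\<^sub>v (mat_adjoint V *\<^sub>v v))"
    using svd_carriers by (intro assoc_mult_mat_vec)
  moreover have "U * S * mat_adjoint V *\<^sub>v v = U * S *\<^sub>v (mat_adjoint V *\<^sub>v v)"
    using svd_carriers assms by (intro assoc_mult_mat_vec mult_carrier_mat)
  ultimately show ?thesis using svd_carriers(9) by simp
qed

lemma pinv_apply:
  assumes "b \<in> carrier_vec r"
  shows "(V * trunc_pinv \<epsilon> S * mat_adjoint U) *\<^sub>v b = V *\<^sub>v (trunc_pinv \<epsilon> S *\<^sub>v (mat_adjoint U *\<^sub>v b))"
proof -
  have "mat_adjoint U *\<^sub>v b \<in> carrier_vec r"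
    using svd_carriers(5) assms by (rule mult_mat_vec_carrier)
  then have "V * trunc_pinv \<epsilon> S *\<^sub>v (mat_adjoint U *\<^sub>v b) = V *\<^sub>v (trunc_pinv \<epsilon> S *\<^sub>v (mat_adjoint U *\<^sub>v b))"
    using svd_carriers by (intro assoc_mult_mat_vec)
  moreover have "V * trunc_pinv \<epsilon> S * mat_adjoint U *\<^sub>v b = V * trunc_pinv \<epsilon> S *\<^sub>v (mat_adjoint U *\<^sub>v b)"
    using svd_carriers assms by (intro assoc_mult_mat_vec mult_carrier_mat)
  ultimately show ?thesis by simp
qed

lemma sigma_index:
  assumes "e \<in> carrier_vec c" "i < r"
  shows "vec_index (S *\<^sub>v e) i = (if i < c then S $$ (i, i) * vec_index e i else 0)"
  using svd assms svd_carriers by (intro diagonal_mat_vec_index) (auto simp: is_svd_def)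

lemma pinv_index:
  assumes "y \<in> carrier_vec r" "i < c"
  shows "vec_index (trunc_pinv \<epsilon> S *\<^sub>v y) i
    = (if i < r \<and> \<epsilon> < Re (S $$ (i, i)) then vec_index y i / S $$ (i, i) else 0)"
proof -
  have "diagonal_mat (trunc_pinv \<epsilon> S)"
    by (auto simp: diagonal_mat_def trunc_pinv_def)
  then show ?thesis
    using diagonal_mat_vec_index[OF svd_carriers(4) _ assms] assms svd_carriers(3)
    by (auto simp: trunc_pinv_def)
qed

lemma sigma_norm: "i < r \<Longrightarrow> i < c \<Longrightarrow> cmod (S $$ (i, i)) = Re (S $$ (i, i))"
proof -
  assume "i < r" "i < c"
  then have "S $$ (i, i) \<in> \<real>" "0 \<le> Re (S $$ (i, i))"
    using svd A by (auto simp: is_svd_def)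
  then show ?thesis by (metis Re_complex_of_real abs_of_nonneg complex_is_Real_iff norm_of_real of_real_Re)
qed

text \<open>In singular coordinates the pseudoinverse divides only by values above \<epsilon>, which
  gives the factor \<open>1 / \<epsilon>\<^sup>2\<close>. Applying \<open>A\<close> afterwards
  multiplies by the same values again and leaves a coordinate projection of the data.\<close>

lemma pinv_bounds:
  assumes b: "b \<in> carrier_vec r"
  defines "d \<equiv> (V * trunc_pinv \<epsilon> S * mat_adjoint U) *\<^sub>v b"
  shows "d \<in> carrier_vec c" "sqn d \<le> sqn b / \<epsilon>\<^sup>2" "sqn (A *\<^sub>v d) \<le> sqn b"
proof -
  define y where "y = mat_adjoint U *\<^sub>v b"
  define e where "e = trunc_pinv \<epsilon> S *\<^sub>v y"
  have y: "y \<in> carrier_vec r" using b svd_carriers(5) by (simp add: y_def)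
  have e: "e \<in> carrier_vec c" using y svd_carriers by (auto simp: e_def intro!: mult_mat_vec_carrier)
  have d: "d = V *\<^sub>v e" using b by (simp add: d_def pinv_apply y_def e_def)
  show dc: "d \<in> carrier_vec c" unfolding d using e svd_carriers by simp
  have sy: "sqn y = sqn b" using b svd_carriers by (simp add: y_def sqn_unitary)
  have "sqn d = sqn e" unfolding d using e svd_carriers by (simp add: sqn_unitary)
  also have "\<dots> \<le> (1 / \<epsilon>)\<^sup>2 * sqn y"
  proof (rule sqn_le)
    fix i assume "i < dim_vec e"
    then have i: "i < c" using e by simp
    have "cmod (vec_index y i) / cmod (S $$ (i, i)) \<le> cmod (vec_index y i) / \<epsilon>"
      if "i < r" "\<epsilon> < Re (S $$ (i, i))"
      using that eps i by (intro divide_left_mono) (auto simp: sigma_norm)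
    then show "vec_index e i = 0 \<or> i < dim_vec y \<and> cmod (vec_index e i) \<le> 1 / \<epsilon> * cmod (vec_index y i)"
      using y i by (auto simp: e_def pinv_index norm_divide)
  qed
  finally show "sqn d \<le> sqn b / \<epsilon>\<^sup>2" by (simp add: sy power_divide)
  have Se: "S *\<^sub>v e \<in> carrier_vec r" using e svd_carriers by (auto intro!: mult_mat_vec_carrier)
  have "A *\<^sub>v d = U *\<^sub>v (S *\<^sub>v e)"
    using dc e by (simp add: svd_apply d unitary_cancel)
  then have "sqn (A *\<^sub>v d) = sqn (S *\<^sub>v e)"
    using Se svd_carriers by (simp add: sqn_unitary)
  also have "\<dots> \<le> 1\<^sup>2 * sqn y"
  proof (rule sqn_le)
    fix i assume "i < dim_vec (S *\<^sub>v e)"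
    then have i: "i < r" using carrier_vecD[OF Se] by simp
    have "S $$ (i, i) \<noteq> 0" if "\<epsilon> < Re (S $$ (i, i))" using that eps by auto
    then show "vec_index (S *\<^sub>v e) i = 0 \<or> i < dim_vec y \<and> cmod (vec_index (S *\<^sub>v e) i) \<le> 1 * cmod (vec_index y i)"
      using y e i by (auto simp: sigma_index e_def[symmetric]) (auto simp: e_def pinv_index split: if_splits)
  qed
  finally show "sqn (A *\<^sub>v d) \<le> sqn b" by (simp add: sy)
qed

text \<open>The residual is the projection of \<open>x\<close> onto the right singular directions
  that the truncation discards. A projection does not increase the norm, and \<open>A\<close>
  stretches these directions by at most \<epsilon>.\<close>

lemma pinv_residual_bounds:
  assumes x: "x \<in> carrier_vec c"
  defines "d \<equiv> x - (V * trunc_pinv \<epsilon> S * mat_adjoint U) *\<^sub>v (A *\<^sub>v x)"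
  shows "d \<in> carrier_vec c" "sqn d \<le> sqn x" "sqn (A *\<^sub>v d) \<le> \<epsilon>\<^sup>2 * sqn x"
proof -
  define y where "y = mat_adjoint V *\<^sub>v x"
  have y: "y \<in> carrier_vec c" using x svd_carriers(6) by (simp add: y_def)
  define t where "t = trunc_pinv \<epsilon> S *\<^sub>v (S *\<^sub>v y)"
  have Sy: "S *\<^sub>v y \<in> carrier_vec r" using y svd_carriers by (auto intro!: mult_mat_vec_carrier)
  have t: "t \<in> carrier_vec c" using Sy svd_carriers by (auto simp: t_def intro!: mult_mat_vec_carrier)
  have Ax: "A *\<^sub>v x = U *\<^sub>v (S *\<^sub>v y)" using x by (simp add: svd_apply y_def)
  then have "A *\<^sub>v x \<in> carrier_vec r" using Sy svd_carriers by simp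
  then have "(V * trunc_pinv \<epsilon> S * mat_adjoint U) *\<^sub>v (A *\<^sub>v x) = V *\<^sub>v t"
    using Sy by (simp add: pinv_apply Ax unitary_cancel t_def)
  moreover have "x = V *\<^sub>v y" using x by (simp add: y_def unitary_cancel)
  ultimately have d: "d = V *\<^sub>v (y - t)"
    using y t svd_carriers mult_minus_distrib_mat_vec[of V c c y t] by (simp add: d_def)
  have yt: "y - t \<in> carrier_vec c" using y t by simp
  show dc: "d \<in> carrier_vec c" unfolding d using yt svd_carriers by simp
  have sy: "sqn y = sqn x" using x svd_carriers by (simp add: y_def sqn_unitary)
  \<comment> \<open>Kept are the coordinates with singular value at most \<epsilon>, and those with
    \<open>i \<ge> r\<close>, which \<open>S\<close> annihilates.\<close>
  have yti: "vec_index (y - t) i = (if i < r \<and> \<epsilon> < Re (S $$ (i, i)) then 0 else vec_index y i)" if "i < c" for i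
  proof -
    have "S $$ (i, i) \<noteq> 0" if "\<epsilon> < Re (S $$ (i, i))" using that eps by auto
    moreover have "vec_index t i = (if i < r \<and> \<epsilon> < Re (S $$ (i, i)) then vec_index (S *\<^sub>v y) i / S $$ (i, i) else 0)"
      unfolding t_def using Sy that by (rule pinv_index)
    ultimately show ?thesis using y t that by (auto simp: sigma_index)
  qed
  have "sqn d = sqn (y - t)" unfolding d using yt svd_carriers by (simp add: sqn_unitary)
  also have "\<dots> \<le> 1\<^sup>2 * sqn y"
  proof (rule sqn_le)
    fix i assume "i < dim_vec (y - t)"
    then have "i < c" using carrier_vecD[OF yt] by simp
    then show "vec_index (y - t) i = 0 \<or> i < dim_vec y \<and> cmod (vec_index (y - t) i) \<le> 1 * cmod (vec_index y i)"
      using yti[of i] y by auto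
  qed
  finally show "sqn d \<le> sqn x" by (simp add: sy)
  have Sd: "S *\<^sub>v (y - t) \<in> carrier_vec r" using yt svd_carriers by (auto intro!: mult_mat_vec_carrier)
  have "A *\<^sub>v d = U *\<^sub>v (S *\<^sub>v (y - t))"
    using dc yt by (simp add: svd_apply d unitary_cancel)
  then have "sqn (A *\<^sub>v d) = sqn (S *\<^sub>v (y - t))"
    using Sd svd_carriers by (simp add: sqn_unitary)
  also have "\<dots> \<le> \<epsilon>\<^sup>2 * sqn y"
  proof (rule sqn_le)
    fix i assume "i < dim_vec (S *\<^sub>v (y - t))"
    then have i: "i < r" using carrier_vecD[OF Sd] by simp
    have "cmod (S $$ (i, i)) * cmod (vec_index y i) \<le> \<epsilon> * cmod (vec_index y i)"
      if "i < c" "\<not> \<epsilon> < Re (S $$ (i, i))"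
      using that i by (intro mult_right_mono) (auto simp: sigma_norm)
    moreover have "vec_index (S *\<^sub>v (y - t)) i = (if i < c then S $$ (i, i) * vec_index (y - t) i else 0)"
      using yt i by (rule sigma_index)
    ultimately show "vec_index (S *\<^sub>v (y - t)) i = 0 \<or>
        i < dim_vec y \<and> cmod (vec_index (S *\<^sub>v (y - t)) i) \<le> \<epsilon> * cmod (vec_index y i)"
      using yti[of i] y i by (auto simp: norm_mult)
  qed
  finally show "sqn (A *\<^sub>v d) \<le> \<epsilon>\<^sup>2 * sqn x" by (simp add: sy)
qed

end

section \<open>Stability of the frame approximation\<close>

lemma psi_poly:
  fixes d :: "nat \<Rightarrow> complex"
  obtains p :: "complex poly" where "Polynomial.degree p \<le> n"
    "\<And>x. poly p (of_real x) = (\<Sum>i=0..n. d i * of_real (psi \<gamma> i x))"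
proof
  define q where "q i = Polynomial.smult (sqrt (real i + 1 / 2) / sqrt \<gamma>) (legendre i \<circ>\<^sub>p [:0, 1 / \<gamma>:])" for i
  have q: "poly (q i) x = psi \<gamma> i x" for i x
    by (simp add: q_def psi_def poly_pcompose)
  have "Polynomial.degree (legendre i \<circ>\<^sub>p [:0, 1 / \<gamma>:]) \<le> i" for i
    using degree_pcompose_le[of "legendre i" "[:0, 1 / \<gamma>:]"]
    by (simp add: degree_legendre split: if_splits)
  then have dq: "Polynomial.degree (q i) \<le> i" for i
    unfolding q_def by (meson degree_smult_le order_trans)
  define p where "p = (\<Sum>i=0..n. Polynomial.smult (d i) (map_poly complex_of_real (q i)))"
  show "Polynomial.degree p \<le> n"
    unfolding p_def
  proof (rule degree_sum_le)
    fix i assume "i \<in> {0..n}"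
    then show "Polynomial.degree (Polynomial.smult (d i) (map_poly complex_of_real (q i))) \<le> n"
      using dq[of i] degree_map_poly_le[of complex_of_real "q i"]
        degree_smult_le[of "d i" "map_poly complex_of_real (q i)"] by auto
  qed simp
  show "poly p (of_real x) = (\<Sum>i=0..n. d i * of_real (psi \<gamma> i x))" for x
    by (simp add: p_def poly_sum of_real_hom.poly_map_poly q)
qed

text \<open>As Legendre polynomials are at most 1 here, the sum is controlled by that of
  \<open>i + 1 / 2\<close>, which is \<open>(n + 1)^2 / 2\<close>. This explains the factor
  \<open>(n + 1) / sqrt \<gamma>\<close> in the threshold \<open>\<epsilon>'\<close>.\<close>

lemma sum_psi_square_le:
  assumes "\<bar>x\<bar> \<le> \<gamma>" "\<gamma> > 0"
  shows "(\<Sum>i=0..n. (psi \<gamma> i x)\<^sup>2) \<le> (real n + 1)\<^sup>2 / (2 * \<gamma>)"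
proof -
  have "(\<Sum>i=0..n. (psi \<gamma> i x)\<^sup>2) \<le> (\<Sum>i=0..n. (real i + 1 / 2) / \<gamma>)"
  proof (rule sum_mono)
    fix i
    have "\<bar>poly (legendre i) (x / \<gamma>)\<bar> \<le> 1"
      using assms by (intro abs_legendre_le_1) (simp add: abs_divide)
    then have "(poly (legendre i) (x / \<gamma>))\<^sup>2 \<le> 1" by (simp add: abs_square_le_1)
    then have "(real i + 1 / 2) * (poly (legendre i) (x / \<gamma>))\<^sup>2 / \<gamma> \<le> (real i + 1 / 2) * 1 / \<gamma>"
      using assms by (intro divide_right_mono mult_left_mono) auto
    then show "(psi \<gamma> i x)\<^sup>2 \<le> (real i + 1 / 2) / \<gamma>"
      using assms by (simp add: psi_def power_divide power_mult_distrib)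
  qed
  also have "\<dots> = (\<Sum>i=0..n. real i + 1 / 2) / \<gamma>" by (rule sum_divide_distrib[symmetric])
  also have "(\<Sum>i=0..n. real i + 1 / 2) = (real n + 1)\<^sup>2 / 2"
    by (induction n) (simp_all add: power2_eq_square field_simps)
  finally show ?thesis by simp
qed

lemma cmod_sum_mult_of_real_le:
  "(cmod (\<Sum>i\<in>I. d i * of_real (a i)))\<^sup>2 \<le> (\<Sum>i\<in>I. (cmod (d i))\<^sup>2) * (\<Sum>i\<in>I. (a i)\<^sup>2)"
proof -
  have "cmod (\<Sum>i\<in>I. d i * of_real (a i)) \<le> (\<Sum>i\<in>I. cmod (d i) * \<bar>a i\<bar>)"
    using norm_sum[of "\<lambda>i. d i * of_real (a i)" I] by (simp add: norm_mult)
  then have "(cmod (\<Sum>i\<in>I. d i * of_real (a i)))\<^sup>2 \<le> (\<Sum>i\<in>I. cmod (d i) * \<bar>a i\<bar>)\<^sup>2"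
    by (intro power_mono) auto
  also have "\<dots> \<le> (\<Sum>i\<in>I. (cmod (d i))\<^sup>2) * (\<Sum>i\<in>I. \<bar>a i\<bar>\<^sup>2)"
    by (rule Cauchy_Schwarz_ineq_sum)
  finally show ?thesis by simp
qed

lemma frame_mat_carrier: "frame_mat \<gamma> m n \<in> carrier_mat (m + 1) (n + 1)"
  by (simp add: frame_mat_def)

lemma frame_mat_apply:
  assumes "d \<in> carrier_vec (n + 1)" "i < m + 1"
  shows "vec_index (frame_mat \<gamma> m n *\<^sub>v d) i
    = of_real (sqrt (2 / (real m + 1))) * (\<Sum>j=0..n. vec_index d j * of_real (psi \<gamma> j (grid_pt m i)))"
proof -
  have "{..<n + 1} = {0..n}" by auto
  then show ?thesis
    using assms unfolding mat_vec_index[OF frame_mat_carrier assms]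
    by (simp add: frame_mat_def sum_distrib_left mult_ac)
qed

text \<open>The two hypotheses on \<open>d\<close> have the form in which \<open>pinv_bounds\<close>
  and \<open>pinv_residual_bounds\<close> deliver their results. One grid value is bounded by the
  whole Euclidean norm, which costs the factor \<open>sqrt (m + 1)\<close>; on [-\<gamma>, \<gamma>]
  Cauchy--Schwarz is used, and the factor \<open>(n + 1) / sqrt \<gamma>\<close> in
  \<open>\<epsilon>'\<close> cancels.\<close>

lemma frame_sum_bound:
  fixes \<beta> \<epsilon> \<gamma> N :: real
  assumes CR: "CR_constant \<beta>" and eps: "0 < \<epsilon>" "\<epsilon> \<le> 1 / exp 1" and g: "\<gamma> > 1"
    and n: "real n \<ge> sqrt (\<gamma>\<^sup>2 - 1) * ln (1 / \<epsilon>)"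
    and m: "real m \<ge> 36 * real n * ln (1 / \<epsilon>) / sqrt (\<gamma>\<^sup>2 - 1)"
    and eps': "\<epsilon>' = \<epsilon> * (real n + 1) / sqrt \<gamma>"
    and d: "d \<in> carrier_vec (n + 1)" and N: "N \<ge> 0"
    and dN: "sqn d \<le> (N / \<epsilon>')\<^sup>2" and AdN: "sqn (frame_mat \<gamma> m n *\<^sub>v d) \<le> N\<^sup>2"
    and x: "\<bar>x\<bar> \<le> 1"
  shows "cmod (\<Sum>i=0..n. vec_index d i * of_real (psi \<gamma> i x)) \<le> (2 * \<beta> + 1) * (sqrt ((real m + 1) / 2) * N)"
proof -
  define K where "K = sqrt ((real m + 1) / 2) * N"
  have K: "K \<ge> 0" using N by (simp add: K_def)
  obtain p :: "complex poly" where p: "Polynomial.degree p \<le> n"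
    "\<And>x. poly p (of_real x) = (\<Sum>i=0..n. vec_index d i * of_real (psi \<gamma> i x))"
    by (rule psi_poly[where d = "vec_index d" and n = n and \<gamma> = \<gamma>]) auto
  have "cmod (poly p (of_real x)) \<le> (2 * \<beta> + 1) * K"
  proof (rule poly_bound_from_grid_scaled[OF CR eps g n m p(1) K _ _ x])
    fix i assume i: "i \<le> m"
    have "(cmod (vec_index (frame_mat \<gamma> m n *\<^sub>v d) i))\<^sup>2 \<le> sqn (frame_mat \<gamma> m n *\<^sub>v d)"
      unfolding sqn_def using i by (intro member_le_sum) (auto simp: frame_mat_def)
    then have "(sqrt (2 / (real m + 1)) * cmod (poly p (of_real (grid_pt m i))))\<^sup>2 \<le> N\<^sup>2"
      using AdN frame_mat_apply[OF d, of i m \<gamma>] i by (simp add: p(2) norm_mult)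
    then have "sqrt (2 / (real m + 1)) * cmod (poly p (of_real (grid_pt m i))) \<le> N"
      by (rule power2_le_imp_le) (rule N)
    then have "sqrt ((real m + 1) / 2) * (sqrt (2 / (real m + 1)) * cmod (poly p (of_real (grid_pt m i)))) \<le> K"
      unfolding K_def by (intro mult_left_mono) auto
    moreover have "sqrt ((real m + 1) / 2) * sqrt (2 / (real m + 1)) = 1"
      by (simp flip: real_sqrt_mult)
    ultimately show "cmod (poly p (of_real (grid_pt m i))) \<le> K"
      by (simp flip: mult.assoc)
  next
    fix t :: real assume t: "\<bar>t\<bar> \<le> \<gamma>"
    have "{..<dim_vec d} = {0..n}" using d by auto
    then have "sqn d = (\<Sum>i=0..n. (cmod (vec_index d i))\<^sup>2)" by (simp add: sqn_def)
    then have "(cmod (poly p (of_real t)))\<^sup>2 \<le> sqn d * (\<Sum>i=0..n. (psi \<gamma> i t)\<^sup>2)"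
      unfolding p(2) using cmod_sum_mult_of_real_le by simp
    also have "\<dots> \<le> (N / \<epsilon>')\<^sup>2 * ((real n + 1)\<^sup>2 / (2 * \<gamma>))"
      using dN t g by (intro mult_mono sum_psi_square_le) (auto simp: sum_nonneg)
    also have "\<dots> = N\<^sup>2 / (2 * \<epsilon>\<^sup>2)"
    proof -
      have "(N / (\<epsilon> * \<nu> / sqrt \<gamma>))\<^sup>2 * (\<nu>\<^sup>2 / (2 * \<gamma>)) = N\<^sup>2 / (2 * \<epsilon>\<^sup>2)" if "\<nu> > 0" for \<nu> :: real
        using g eps that by (simp add: power_divide power_mult_distrib field_simps)
      then show ?thesis unfolding eps' by simp
    qed
    \<comment> \<open>A factor at least 1 is given away so that the same \<open>K\<close> serves on
      the grid and on [-\<gamma>, \<gamma>].\<close>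
    also have "\<dots> \<le> (real m + 1) * (N\<^sup>2 / (2 * \<epsilon>\<^sup>2))"
      using mult_right_mono[of 1 "real m + 1" "N\<^sup>2 / (2 * \<epsilon>\<^sup>2)"] by simp
    also have "\<dots> = (K / \<epsilon>)\<^sup>2"
      by (simp add: K_def power_divide power_mult_distrib)
    finally show "cmod (poly p (of_real t)) \<le> K / \<epsilon>"
      by (rule power2_le_imp_le) (use K eps in simp)
  qed
  then show ?thesis by (simp add: p(2) K_def)
qed

section \<open>The frame approximation as a bounded linear operator on grid data\<close>

lemma grid_norm_upper: "i \<le> m \<Longrightarrow> cmod (h (grid_pt m i)) \<le> grid_norm m h"
  unfolding grid_norm_def by (intro Max_ge) auto

lemma grid_norm_nonneg: "grid_norm m h \<ge> 0"
  using grid_norm_upper[of 0 m h] by (meson le0 norm_ge_zero order_trans)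

lemma grid_norm_scale: "a \<ge> 0 \<Longrightarrow> grid_norm m (\<lambda>t. of_real a * h t) = a * grid_norm m h"
proof -
  assume "a \<ge> 0"
  then have "mono (\<lambda>t. a * t)" by (intro monoI mult_left_mono)
  then have "a * Max ((\<lambda>i. cmod (h (grid_pt m i))) ` {0..m}) = Max ((\<lambda>t. a * t) ` (\<lambda>i. cmod (h (grid_pt m i))) ` {0..m})"
    by (intro mono_Max_commute) auto
  with \<open>a \<ge> 0\<close> show ?thesis by (simp add: grid_norm_def norm_mult image_image)
qed

text \<open>The squared weights \<open>2 / (m + 1)\<close> at \<open>m + 1\<close> points sum to
  2.\<close>

lemma sqn_data_vec_le: "sqn (data_vec m h) \<le> (sqrt 2 * grid_norm m h)\<^sup>2"
proof -
  have "sqn (data_vec m h) = (\<Sum>i<m + 1. 2 / (real m + 1) * (cmod (h (grid_pt m i)))\<^sup>2)"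
    by (simp add: sqn_def data_vec_def norm_mult power_mult_distrib)
  also have "\<dots> \<le> (\<Sum>i<m + 1. 2 / (real m + 1) * (grid_norm m h)\<^sup>2)"
    by (intro sum_mono mult_left_mono power_mono grid_norm_upper) auto
  also have "\<dots> = 2 * (grid_norm m h)\<^sup>2" by (simp add: add.commute field_simps)
  finally show ?thesis by (simp add: power_mult_distrib)
qed

lemma data_vec_carrier: "data_vec m f \<in> carrier_vec (m + 1)"
  by (simp add: data_vec_def)

lemma data_vec_add: "data_vec m (\<lambda>t. f t + h t) = data_vec m f + data_vec m h"
  by (rule eq_vecI) (auto simp: data_vec_def algebra_simps)

lemma data_vec_scale: "data_vec m (\<lambda>t. a * f t) = a \<cdot>\<^sub>v data_vec m f"
  by (rule eq_vecI) (auto simp: data_vec_def algebra_simps)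

context
  fixes \<beta> \<epsilon> \<epsilon>' \<gamma> :: real and m n :: nat and U S V :: "complex mat"
  assumes CR: "CR_constant \<beta>" and eps: "0 < \<epsilon>" "\<epsilon> \<le> 1 / exp 1" and g: "\<gamma> > 1"
    and n: "real n \<ge> sqrt (\<gamma>\<^sup>2 - 1) * ln (1 / \<epsilon>)"
    and m: "real m \<ge> 36 * real n * ln (1 / \<epsilon>) / sqrt (\<gamma>\<^sup>2 - 1)"
    and eps': "\<epsilon>' = \<epsilon> * (real n + 1) / sqrt \<gamma>"
    and svd: "is_svd (frame_mat \<gamma> m n) U S V"
begin

lemma eps'_pos: "\<epsilon>' > 0"
  using eps g by (simp add: eps')

lemmas pinv_carrier = mult_carrier_mat[OF mult_carrier_mat[OF svd_carriers(2,4)] svd_carriers(5),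
    OF svd frame_mat_carrier eps'_pos svd frame_mat_carrier eps'_pos svd frame_mat_carrier eps'_pos]

lemma frame_coeffs_carrier: "frame_coeffs U S V \<epsilon>' m f \<in> carrier_vec (n + 1)"
  unfolding frame_coeffs_def by (rule mult_mat_vec_carrier[OF pinv_carrier data_vec_carrier])

lemma frame_approx_add:
  "frame_approx U S V \<epsilon>' \<gamma> m n (\<lambda>t. f t + h t) x
    = frame_approx U S V \<epsilon>' \<gamma> m n f x + frame_approx U S V \<epsilon>' \<gamma> m n h x"
proof -
  have "frame_coeffs U S V \<epsilon>' m (\<lambda>t. f t + h t) = frame_coeffs U S V \<epsilon>' m f + frame_coeffs U S V \<epsilon>' m h"
    unfolding frame_coeffs_def data_vec_add
    by (rule mult_add_distrib_mat_vec[OF pinv_carrier data_vec_carrier data_vec_carrier])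
  then show ?thesis
    using frame_coeffs_carrier[of h] by (simp add: frame_approx_def distrib_right sum.distrib)
qed

lemma frame_approx_scale:
  "frame_approx U S V \<epsilon>' \<gamma> m n (\<lambda>t. a * f t) x = a * frame_approx U S V \<epsilon>' \<gamma> m n f x"
proof -
  have "frame_coeffs U S V \<epsilon>' m (\<lambda>t. a * f t) = a \<cdot>\<^sub>v frame_coeffs U S V \<epsilon>' m f"
    unfolding frame_coeffs_def data_vec_scale
    by (rule mult_mat_vec[OF pinv_carrier data_vec_carrier])
  then show ?thesis
    using frame_coeffs_carrier[of f] by (simp add: frame_approx_def sum_distrib_left mult_ac)
qed

text \<open>\<open>pinv_bounds\<close> feeds \<open>frame_sum_bound\<close> with
  \<open>N = sqrt 2 * grid_norm m h\<close>; this \<open>sqrt 2\<close> cancels against the one in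
  \<open>sqrt ((m + 1) / 2)\<close>.\<close>

lemma frame_approx_bound:
  assumes "\<bar>x\<bar> \<le> 1"
  shows "cmod (frame_approx U S V \<epsilon>' \<gamma> m n h x) \<le> (2 * \<beta> + 1) * sqrt (real m + 1) * grid_norm m h"
proof -
  define N where "N = sqrt 2 * grid_norm m h"
  have N: "N \<ge> 0" by (simp add: N_def grid_norm_nonneg)
  have b: "sqn (data_vec m h) \<le> N\<^sup>2" using sqn_data_vec_le by (simp add: N_def)
  note P = pinv_bounds[OF svd frame_mat_carrier eps'_pos data_vec_carrier, of h, folded frame_coeffs_def]
  have "sqn (data_vec m h) / \<epsilon>'\<^sup>2 \<le> N\<^sup>2 / \<epsilon>'\<^sup>2"
    using b by (intro divide_right_mono) auto
  then have "sqn (frame_coeffs U S V \<epsilon>' m h) \<le> (N / \<epsilon>')\<^sup>2"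
    using P(2) by (simp add: power_divide)
  then have "cmod (frame_approx U S V \<epsilon>' \<gamma> m n h x) \<le> (2 * \<beta> + 1) * (sqrt ((real m + 1) / 2) * N)"
    unfolding frame_approx_def using P(3) b
    by (intro frame_sum_bound[OF CR eps g n m eps' P(1) N _ _ assms]) auto
  moreover have "sqrt ((real m + 1) / 2) * N = sqrt (real m + 1) * grid_norm m h"
    by (simp add: N_def real_sqrt_divide)
  ultimately show ?thesis by (simp add: mult.assoc)
qed

text \<open>Let \<open>Q\<close> be the frame sum with coefficients \<open>u\<close>. The three
  terms bound \<open>f - Q\<close>, \<open>Q - R Q\<close> and \<open>R (f - Q)\<close>, where
  \<open>R\<close> is the approximation operator.\<close>

lemma frame_approx_error:
  assumes q: "\<And>x. \<bar>x\<bar> \<le> 1 \<Longrightarrow> cmod (f x - (\<Sum>i=0..n. vec_index u i * of_real (psi \<gamma> i x))) \<le> E"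
    and u: "u \<in> carrier_vec (n + 1)" "sqn u \<le> X\<^sup>2" "X \<ge> 0" and m0: "m > 0" and x: "\<bar>x\<bar> \<le> 1"
  shows "cmod (f x - frame_approx U S V \<epsilon>' \<gamma> m n f x)
    \<le> E + (2 * \<beta> + 1) * (sqrt ((real m + 1) / 2) * (\<epsilon>' * X)) + (2 * \<beta> + 1) * sqrt (real m + 1) * E"
proof -
  define R where "R = frame_approx U S V \<epsilon>' \<gamma> m n"
  define Q where "Q t = (\<Sum>i=0..n. vec_index u i * of_real (psi \<gamma> i t))" for t
  define h where "h t = f t - Q t" for t
  have Rf: "R f x = R Q x + R h x"
    using frame_approx_add[of Q h x] by (simp add: R_def h_def)
  have "grid_norm m h \<le> E"
    unfolding grid_norm_def
  proof (intro Max.boundedI)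
    fix a assume "a \<in> (\<lambda>i. cmod (h (grid_pt m i))) ` {0..m}"
    then obtain i where i: "i \<le> m" "a = cmod (h (grid_pt m i))" by auto
    have "\<bar>grid_pt m i\<bar> \<le> 1" using i m0 by (simp add: grid_pt_def abs_le_iff field_simps)
    then show "a \<le> E" using q by (simp add: i h_def Q_def)
  qed auto
  moreover have "2 * \<beta> + 1 \<ge> 0" using CR by (simp add: CR_constant_def)
  ultimately have "(2 * \<beta> + 1) * sqrt (real m + 1) * grid_norm m h \<le> (2 * \<beta> + 1) * sqrt (real m + 1) * E"
    by (intro mult_left_mono) auto
  then have Rh: "cmod (R h x) \<le> (2 * \<beta> + 1) * sqrt (real m + 1) * E"
    using frame_approx_bound[OF x, of h] by (simp add: R_def)
  \<comment> \<open>The data of \<open>Q\<close> lie in the range of the frame matrix, so the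
    coefficient error of \<open>R Q\<close> is the residual treated by
    \<open>pinv_residual_bounds\<close>.\<close>
  have dQ: "data_vec m Q = frame_mat \<gamma> m n *\<^sub>v u"
  proof (rule eq_vecI)
    show "dim_vec (data_vec m Q) = dim_vec (frame_mat \<gamma> m n *\<^sub>v u)"
      by (simp add: data_vec_def frame_mat_def)
    fix i assume "i < dim_vec (frame_mat \<gamma> m n *\<^sub>v u)"
    then have "i < m + 1" by (simp add: frame_mat_def)
    then show "vec_index (data_vec m Q) i = vec_index (frame_mat \<gamma> m n *\<^sub>v u) i"
      using frame_mat_apply[OF u(1), of i m \<gamma>] by (simp add: data_vec_def Q_def)
  qed
  define d where "d = u - frame_coeffs U S V \<epsilon>' m Q"
  note P = pinv_residual_bounds[OF svd frame_mat_carrier eps'_pos u(1), folded dQ,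
      folded frame_coeffs_def, folded d_def]
  have "Q x - R Q x = (\<Sum>i=0..n. vec_index d i * of_real (psi \<gamma> i x))"
    using u frame_coeffs_carrier[of Q]
    by (simp add: Q_def R_def frame_approx_def d_def left_diff_distrib sum_subtractf)
  moreover have "cmod (\<Sum>i=0..n. vec_index d i * of_real (psi \<gamma> i x))
      \<le> (2 * \<beta> + 1) * (sqrt ((real m + 1) / 2) * (\<epsilon>' * X))"
  \<comment> \<open>Here \<open>N = \<epsilon>' * X\<close>: the residual is bounded by
    \<open>X\<close>, and its image under the frame matrix by
    \<open>\<epsilon>' * X\<close>.\<close>
  proof (rule frame_sum_bound[OF CR eps g n m eps' P(1) _ _ _ x])
    show "\<epsilon>' * X \<ge> 0" using eps'_pos u by simp
    show "sqn d \<le> (\<epsilon>' * X / \<epsilon>')\<^sup>2" using P(2) u(2) eps'_pos by simp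
    have "\<epsilon>'\<^sup>2 * sqn u \<le> \<epsilon>'\<^sup>2 * X\<^sup>2" using u(2) by (intro mult_left_mono) auto
    then show "sqn (frame_mat \<gamma> m n *\<^sub>v d) \<le> (\<epsilon>' * X)\<^sup>2"
      using P(3) by (simp add: power_mult_distrib)
  qed
  moreover have "f x - R f x = (f x - Q x) + (Q x - R Q x) + - R h x"
    by (simp add: Rf)
  then have "cmod (f x - R f x) \<le> cmod (f x - Q x) + cmod (Q x - R Q x) + cmod (R h x)"
    by (metis norm_minus_cancel norm_triangle_le norm_triangle_ineq add_mono order_refl)
  moreover have "cmod (f x - Q x) \<le> E" using q[OF x] by (simp add: Q_def)
  ultimately show ?thesis using Rh by (simp add: R_def)
qed

end

section \<open>The condition number of a linear operator\<close>

text \<open>By additivity the quotient does not depend on \<open>f\<close>, and by homogeneity the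
  supremum over small \<open>h\<close> does not depend on \<delta>. The condition number is thus the
  operator norm \<open>K\<close>.\<close>

lemma cond_number_le:
  fixes R :: "(real \<Rightarrow> complex) \<Rightarrow> real \<Rightarrow> complex"
  assumes add: "\<And>f h x. R (\<lambda>t. f t + h t) x = R f x + R h x"
    and scale: "\<And>a h x. R (\<lambda>t. of_real a * h t) x = of_real a * R h x"
    and bound: "\<And>h x. \<bar>x\<bar> \<le> 1 \<Longrightarrow> cmod (R h x) \<le> C * grid_norm m h"
  shows "cond_number m R \<le> ereal C"
proof -
  define K where "K = (SUP h\<in>{h \<in> C_interval. 0 < grid_norm m h}. ereal (sup_norm {-1..1} (R h) / grid_norm m h))"
  have bdd: "bdd_above ((\<lambda>x. cmod (R h x)) ` {-1..1})" for h
    using bound[of _ h] by (intro bdd_aboveI[of _ "C * grid_norm m h"]) (auto simp: abs_le_iff)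
  have eq: "(SUP h\<in>{h \<in> C_interval. 0 < grid_norm m h \<and> grid_norm m h \<le> \<delta>}.
      ereal (sup_norm {-1..1} (\<lambda>x. R (\<lambda>t. f t + h t) x - R f x) / grid_norm m h)) = K"
    if \<delta>: "\<delta> > 0" for \<delta> f
    unfolding K_def
  proof (rule SUP_eq)
    fix h assume "h \<in> {h \<in> C_interval. 0 < grid_norm m h \<and> grid_norm m h \<le> \<delta>}"
    then show "\<exists>h'\<in>{h \<in> C_interval. 0 < grid_norm m h}.
        ereal (sup_norm {-1..1} (\<lambda>x. R (\<lambda>t. f t + h t) x - R f x) / grid_norm m h)
        \<le> ereal (sup_norm {-1..1} (R h') / grid_norm m h')"
      by (intro bexI[of _ h]) (auto simp: add)
  next
    fix h assume h: "h \<in> {h \<in> C_interval. 0 < grid_norm m h}"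
    \<comment> \<open>This scales \<open>h\<close> to grid norm exactly \<delta>, leaving its
      quotient unchanged.\<close>
    define a where "a = \<delta> / grid_norm m h"
    define h' where "h' = (\<lambda>t. of_real a * h t)"
    have a: "a > 0" using h \<delta> by (simp add: a_def)
    have gh': "grid_norm m h' = a * grid_norm m h"
      unfolding h'_def using a by (intro grid_norm_scale) simp
    have "sup_norm {-1..1} (R h) \<le> sup_norm {-1..1} (R h') / a"
      unfolding sup_norm_def
    proof (rule cSUP_least)
      fix x :: real assume x: "x \<in> {-1..1}"
      have "a * cmod (R h x) = cmod (R h' x)"
        using a by (simp add: h'_def scale norm_mult)
      also have "\<dots> \<le> (SUP x\<in>{-1..1}. cmod (R h' x))"
        using x bdd by (rule cSUP_upper)
      finally show "cmod (R h x) \<le> (SUP x\<in>{-1..1}. cmod (R h' x)) / a"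
        using a by (simp add: le_divide_eq mult.commute)
    qed simp
    then have "sup_norm {-1..1} (R h) / grid_norm m h \<le> sup_norm {-1..1} (R h') / a / grid_norm m h"
      using h by (intro divide_right_mono) auto
    then have "sup_norm {-1..1} (R h) / grid_norm m h \<le> sup_norm {-1..1} (R h') / grid_norm m h'"
      by (simp add: gh')
    moreover have "h' \<in> C_interval"
      using h by (auto simp: h'_def C_interval_def intro!: continuous_intros)
    ultimately show "\<exists>h'\<in>{h \<in> C_interval. 0 < grid_norm m h \<and> grid_norm m h \<le> \<delta>}.
        ereal (sup_norm {-1..1} (R h) / grid_norm m h)
        \<le> ereal (sup_norm {-1..1} (\<lambda>x. R (\<lambda>t. f t + h' t) x - R f x) / grid_norm m h')"
      using a h \<delta> by (intro bexI[of _ h']) (auto simp: add gh', auto simp: a_def)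
  qed
  \<comment> \<open>\<open>Lim\<close> is only meaningful once convergence is shown; here the
    function is constant for positive \<delta>.\<close>
  have "Lim (at_right (0::real)) (\<lambda>\<delta>.
          SUP h\<in>{h \<in> C_interval. 0 < grid_norm m h \<and> grid_norm m h \<le> \<delta>}.
            ereal (sup_norm {-1..1} (\<lambda>x. R (\<lambda>t. f t + h t) x - R f x) / grid_norm m h)) = K" for f
  proof (rule tendsto_Lim)
    show "((\<lambda>\<delta>. SUP h\<in>{h \<in> C_interval. 0 < grid_norm m h \<and> grid_norm m h \<le> \<delta>}.
            ereal (sup_norm {-1..1} (\<lambda>x. R (\<lambda>t. f t + h t) x - R f x) / grid_norm m h)) \<longlongrightarrow> K) (at_right 0)"
      by (rule tendsto_eventually) (auto simp: eventually_at_filter eq)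
  qed simp
  moreover have "K \<le> ereal C"
    unfolding K_def
  proof (rule SUP_least)
    fix h assume h: "h \<in> {h \<in> C_interval. 0 < grid_norm m h}"
    have "sup_norm {-1..1} (R h) \<le> C * grid_norm m h"
      unfolding sup_norm_def by (rule cSUP_least) (auto simp: abs_le_iff intro!: bound)
    then show "ereal (sup_norm {-1..1} (R h) / grid_norm m h) \<le> ereal C"
      using h by (simp add: divide_le_eq)
  qed
  ultimately show ?thesis
    unfolding cond_number_def by (intro SUP_least) simp
qed

section \<open>Chebyshev approximation of analytic functions\<close>

fun cheb :: "nat \<Rightarrow> real poly" where
  "cheb 0 = 1"
| "cheb (Suc 0) = [:0, 1:]"
| "cheb (Suc (Suc k)) = [:0, 2:] * cheb (Suc k) - cheb k"

lemma degree_cheb: "Polynomial.degree (cheb k) \<le> k"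
proof (induction k rule: cheb.induct)
  case (3 k)
  have "Polynomial.degree ([:0, 2:] * cheb (Suc k)) \<le> Suc (Suc k)"
    using degree_mult_le[of "[:0, 2:]" "cheb (Suc k)"] 3 by simp
  then show ?case using 3 by (simp only: cheb.simps) (intro degree_diff_le, auto)
qed auto

lemma cheb_cos: "poly (cheb k) (cos t) = cos (real k * t)"
proof (induction k rule: cheb.induct)
  case (3 k)
  have "cos (real (Suc (Suc k)) * t) + cos (real k * t) = 2 * cos t * cos (real (Suc k) * t)"
    using cos_add[of "real (Suc k) * t" t] cos_diff[of "real (Suc k) * t" t]
    by (simp add: algebra_simps)
  then show ?case using 3 by (simp add: algebra_simps)
qed auto

lemma cheb_joukowski:
  assumes "t \<noteq> 0"
  shows "poly (cheb k) ((t + 1 / t) / 2) = (t ^ k + 1 / t ^ k) / 2"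
proof (induction k rule: cheb.induct)
  case (3 k)
  have E: "(t + 1 / t) * (t ^ Suc k + 1 / t ^ Suc k)
      = (t ^ Suc (Suc k) + 1 / t ^ Suc (Suc k)) + (t ^ k + 1 / t ^ k)"
    using assms by (simp add: field_simps)
  have "poly [:0, 2:] ((t + 1 / t) / 2) = t + 1 / t" by simp
  then show ?case
    unfolding cheb.simps poly_diff poly_mult 3 by (simp only: times_divide_eq_right E) (simp add: add_divide_distrib)
qed auto

text \<open>On [-1, 1] the cosine formula gives the bound 1. Elsewhere
  \<open>x = (t + 1 / t) / 2\<close> with real \<open>t\<close>, and the polynomial is the mean of
  \<open>t ^ k\<close> and its inverse.\<close>

lemma abs_cheb_le:
  assumes x: "\<bar>x\<bar> \<le> \<gamma>" and g: "\<gamma> > 1"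
  shows "\<bar>poly (cheb k) x\<bar> \<le> (\<gamma> + sqrt (\<gamma>\<^sup>2 - 1)) ^ k"
proof -
  define \<tau> where "\<tau> = \<gamma> + sqrt (\<gamma>\<^sup>2 - 1)"
  have \<tau>: "\<tau> \<ge> 1" using g by (simp add: \<tau>_def add_increasing2 one_le_power)
  show ?thesis
  proof (cases "\<bar>x\<bar> \<le> 1")
    case True
    then have "\<bar>poly (cheb k) x\<bar> \<le> 1"
      using cheb_cos[of k "arccos x"] by (simp add: abs_le_iff)
    also have "1 \<le> \<tau> ^ k" using \<tau> by simp
    finally show ?thesis by (simp add: \<tau>_def)
  next
    case False
    define r where "r = sqrt (x\<^sup>2 - 1)"
    have x1: "1 < x\<^sup>2" using False abs_square_le_1[of x] by linarith
    have r: "r \<ge> 0" "r\<^sup>2 = x\<^sup>2 - 1" using x1 by (simp_all add: r_def)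
    \<comment> \<open>The sign selects the root of modulus \<open>\<bar>x\<bar> + r\<close>, which
      exceeds 1 and increases with \<open>\<bar>x\<bar>\<close>.\<close>
    define t where "t = x + sgn x * r"
    have sg: "sgn x * sgn x = 1" "\<bar>sgn x\<bar> = 1" "sgn x * \<bar>x\<bar> = x" using False by (auto simp: sgn_if)
    have "t * (x - sgn x * r) = x\<^sup>2 - (sgn x * sgn x) * r\<^sup>2"
      by (simp add: t_def algebra_simps power2_eq_square)
    then have t1: "t * (x - sgn x * r) = 1" using r sg by simp
    then have t0: "t \<noteq> 0" by auto
    then have "1 / t = x - sgn x * r" using t1 by (simp add: field_simps)
    then have xt: "x = (t + 1 / t) / 2" by (simp add: t_def)
    have "t = sgn x * (\<bar>x\<bar> + r)" using sg by (simp add: t_def distrib_left)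
    then have at: "\<bar>t\<bar> = \<bar>x\<bar> + r" using sg r by (simp add: abs_mult)
    have "x\<^sup>2 \<le> \<gamma>\<^sup>2" using x by (metis abs_ge_zero power2_abs power_mono)
    then have "r \<le> sqrt (\<gamma>\<^sup>2 - 1)" by (simp add: r_def)
    then have t\<tau>: "\<bar>t\<bar> \<le> \<tau>" using at x by (simp add: \<tau>_def)
    have ge1: "\<bar>t\<bar> ^ k \<ge> 1" using at r False by simp
    then have "1 / \<bar>t\<bar> ^ k \<le> 1" by (simp add: divide_le_eq)
    then have "1 / \<bar>t\<bar> ^ k \<le> \<bar>t\<bar> ^ k" using ge1 by linarith
    then have "\<bar>(t ^ k + 1 / t ^ k) / 2\<bar> \<le> \<bar>t\<bar> ^ k"
      using abs_triangle_ineq[of "t ^ k" "1 / t ^ k"] by (simp add: power_abs)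
    also have "\<dots> \<le> \<tau> ^ k" using t\<tau> by (intro power_mono) auto
    finally show ?thesis
      unfolding \<tau>_def cheb_joukowski[OF t0, of k, folded xt] .
  qed
qed

section \<open>Laurent expansion with explicit remainder\<close>

text \<open>The straight homotopy between concentric circles is radial, so it stays inside the
  annulus.\<close>

lemma annulus_circle_deform:
  assumes f: "f holomorphic_on {w. r1 < cmod w \<and> cmod w < r2}"
    and a: "0 < r1" "r1 < a" "a < r2" and b: "r1 < b" "b < r2"
  shows "contour_integral (circlepath 0 a) f = contour_integral (circlepath 0 b) f"
proof (rule Cauchy_theorem_homotopic_loops[OF _ _ f])
  show "open {w::complex. r1 < cmod w \<and> cmod w < r2}"
    by (intro open_Collect_conj open_Collect_less continuous_intros)
  show "homotopic_loops {w. r1 < cmod w \<and> cmod w < r2} (circlepath 0 a) (circlepath 0 b)"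
  proof (rule homotopic_loops_linear)
    fix t :: real
    show "closed_segment (circlepath 0 a t) (circlepath 0 b t) \<subseteq> {w. r1 < cmod w \<and> cmod w < r2}"
    proof
      fix w assume "w \<in> closed_segment (circlepath 0 a t) (circlepath 0 b t)"
      then obtain u where u: "0 \<le> u" "u \<le> 1" "w = (1 - u) *\<^sub>R circlepath 0 a t + u *\<^sub>R circlepath 0 b t"
        by (auto simp: in_segment)
      define e where "e = exp (2 * of_real pi * \<i> * of_real t)"
      have "w = of_real ((1 - u) * a + u * b) * e"
        by (simp add: u circlepath e_def scaleR_conv_of_real algebra_simps)
      moreover have "cmod e = 1" by (simp add: e_def)
      ultimately have "cmod w = \<bar>(1 - u) * a + u * b\<bar>" by (simp add: norm_mult del: of_real_add of_real_mult of_real_diff)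
      moreover have "r1 < (1 - u) * a + u * b" "(1 - u) * a + u * b < r2"
        using u a b convex_bound_lt[of a r2 b "1 - u" u] convex_bound_lt[of "- a" "- r1" "- b" "1 - u" u]
        by (simp_all add: algebra_simps)
      ultimately show "w \<in> {w. r1 < cmod w \<and> cmod w < r2}" using a by simp
    qed
  qed auto
qed auto

(* The divided difference of F at z is holomorphic, so its integrals over the two circles agree. *)
lemma cauchy_formula_annulus:
  assumes f: "F holomorphic_on {w. r1 < cmod w \<and> cmod w < r2}"
    and r: "0 < r1" "r1 < a" "a < cmod z" "cmod z < b" "b < r2"
  shows "2 * of_real pi * \<i> * F z = contour_integral (circlepath 0 b) (\<lambda>w. F w / (w - z))
      - contour_integral (circlepath 0 a) (\<lambda>w. F w / (w - z))"
proof -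
  define A where "A = {w::complex. r1 < cmod w \<and> cmod w < r2}"
  define D where "D = (\<lambda>w. if w = z then deriv F z else F w / (w - z) - F z / (w - z))"
  have oA: "open A" unfolding A_def by (intro open_Collect_conj open_Collect_less continuous_intros)
  have zA: "z \<in> A" using r by (simp add: A_def)
  have D: "D holomorphic_on A"
    unfolding D_def using f[folded A_def] oA zA
    by (intro pole_theorem) (auto simp: interior_open)
  have eq: "contour_integral (circlepath 0 b) D = contour_integral (circlepath 0 a) D"
    by (rule annulus_circle_deform[OF D[unfolded A_def]]) (use r in auto)
  have circ: "contour_integral (circlepath 0 c) D
      = contour_integral (circlepath 0 c) (\<lambda>w. F w / (w - z)) - F z * contour_integral (circlepath 0 c) (\<lambda>w. 1 / (w - z))"
    if c: "r1 < c" "c < r2" "c \<noteq> cmod z" for c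
  proof -
    have c0: "c > 0" using c r by simp
    have im: "path_image (circlepath 0 c) \<subseteq> A - {z}"
      using c c0 by (auto simp: A_def)
    have i1: "(\<lambda>w. F w / (w - z)) contour_integrable_on circlepath 0 c"
      using im f[folded A_def, THEN holomorphic_on_imp_continuous_on]
      by (intro contour_integrable_continuous_circlepath continuous_intros) (auto elim: continuous_on_subset)
    have i2: "(\<lambda>w. 1 / (w - z)) contour_integrable_on circlepath 0 c"
      using im by (intro contour_integrable_continuous_circlepath continuous_intros) auto
    have "contour_integral (circlepath 0 c) D
        = contour_integral (circlepath 0 c) (\<lambda>w. F w / (w - z) - F z * (1 / (w - z)))"
      using im by (intro contour_integral_cong) (auto simp: D_def)
    then show ?thesis
      by (simp only: contour_integral_diff[OF i1 contour_integrable_lmul[OF i2]] contour_integral_lmul[OF i2])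
  qed
  \<comment> \<open>The point \<open>z\<close> lies inside the circle of radius \<open>b\<close> and
    outside that of radius \<open>a\<close>, so the kernel integrates to 2 pi i and 0
    respectively.\<close>
  have "((\<lambda>u. 1 / (u - z)) has_contour_integral 2 * of_real pi * \<i> * 1) (circlepath 0 b)"
    using r Cauchy_integral_circlepath_simple[of "\<lambda>_. 1" 0 b z] by simp
  then have 1: "contour_integral (circlepath 0 b) (\<lambda>u. 1 / (u - z)) = 2 * of_real pi * \<i>"
    using contour_integral_unique by fastforce
  have "((\<lambda>u. 1 / (u - z)) has_contour_integral 0) (circlepath 0 a)"
    using r by (intro Cauchy_theorem_disc_simple[of _ 0 "cmod z"]) (auto intro!: holomorphic_intros)
  then have 2: "contour_integral (circlepath 0 a) (\<lambda>u. 1 / (u - z)) = 0"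
    by (rule contour_integral_unique)
  show ?thesis
    using eq circ[of a] circ[of b] r by (simp add: 1 2 algebra_simps)
qed

lemma circle_integral_bound:
  assumes "f contour_integrable_on circlepath 0 r" "r > 0" "B \<ge> 0"
    "\<And>w. cmod w = r \<Longrightarrow> cmod (f w) \<le> B"
  shows "cmod (contour_integral (circlepath 0 r) f / (2 * of_real pi * \<i>)) \<le> B * r"
proof -
  have "cmod (contour_integral (circlepath 0 r) f) \<le> B * (2 * pi * r)"
    using assms by (intro has_contour_integral_bound_circlepath[OF has_contour_integral_integral]) auto
  then show ?thesis by (simp add: norm_divide norm_mult field_simps)
qed

text \<open>A finite geometric sum with exact remainder, so that the Laurent expansion involves no
  interchange of limit and integral.\<close>

lemma geometric_kernel_outer:
  fixes w z :: complex
  assumes "w \<noteq> 0" "w \<noteq> z"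
  shows "1 / (w - z) = (\<Sum>k=0..n. z ^ k / w ^ Suc k) + (z / w) ^ Suc n / (w - z)"
proof (induction n)
  case 0
  show ?case using assms by (simp add: field_simps)
next
  case (Suc n)
  have "(z / w) ^ Suc n / (w - z) = z ^ Suc n / w ^ Suc (Suc n) + (z / w) ^ Suc (Suc n) / (w - z)"
  proof -
    have "(z / w) ^ Suc (Suc n) = (z / w) ^ Suc n * (z / w)" by simp
    moreover have "z ^ Suc n / w ^ Suc (Suc n) = (z / w) ^ Suc n * (1 / w)" by (simp add: power_divide)
    moreover have "1 / (w - z) = 1 / w + (z / w) / (w - z)" using assms by (simp add: field_simps)
    ultimately show ?thesis
      by (metis (no_types, lifting) distrib_left mult.right_neutral times_divide_eq_right)
  qed
  then show ?case using Suc by simp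
qed

lemma geometric_kernel_inner:
  fixes w z :: complex
  assumes "z \<noteq> 0" "w \<noteq> z"
  shows "1 / (z - w) = (\<Sum>k=1..n. w ^ (k - 1) / z ^ k) + (w / z) ^ n / (z - w)"
proof (induction n)
  case (Suc n)
  have "(w / z) ^ n / (z - w) = w ^ n / z ^ Suc n + (w / z) ^ Suc n / (z - w)"
  proof -
    have "(w / z) ^ Suc n = (w / z) ^ n * (w / z)" by simp
    moreover have "w ^ n / z ^ Suc n = (w / z) ^ n * (1 / z)" by (simp add: power_divide)
    moreover have "1 / (z - w) = 1 / z + (w / z) / (z - w)" using assms by (simp add: field_simps)
    ultimately show ?thesis
      by (metis (no_types, lifting) distrib_left mult.right_neutral times_divide_eq_right)
  qed
  then show ?case using Suc by simp
qed simp

lemma contour_integral_sum_plus: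
  assumes "finite I" "\<And>k. k \<in> I \<Longrightarrow> f k contour_integrable_on p" "g contour_integrable_on p"
  shows "contour_integral p (\<lambda>w. (\<Sum>k\<in>I. c k * f k w) + g w)
    = (\<Sum>k\<in>I. c k * contour_integral p (f k)) + contour_integral p g"
  using assms
  by (intro contour_integral_unique has_contour_integral_add has_contour_integral_sum
      has_contour_integral_lmul has_contour_integral_integral) auto

text \<open>In Cauchy's formula for the circles of radius \<open>R\<close> and \<open>1 / R\<close>
  the kernels are expanded outward and inward. Bounding integrands by \<open>B\<close> controls the
  coefficients, and each of the two remainders is at most
  \<open>B / (R ^ n * (R - 1))\<close>.\<close>

lemma laurent_truncation:
  assumes F: "F holomorphic_on {w. 1 / \<theta> < cmod w \<and> cmod w < \<theta>}"
    and B: "\<And>w. 1 / \<theta> < cmod w \<Longrightarrow> cmod w < \<theta> \<Longrightarrow> cmod (F w) \<le> B"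
    and R: "1 < R" "R < \<theta>"
  obtains \<alpha> \<alpha>' :: "nat \<Rightarrow> complex" where
    "\<And>k. cmod (\<alpha> k) \<le> B / R ^ k" "\<And>k. cmod (\<alpha>' k) \<le> B / R ^ k"
    "\<And>z. cmod z = 1 \<Longrightarrow> cmod (F z - ((\<Sum>k=0..n. \<alpha> k * z ^ k) + (\<Sum>k=1..n. \<alpha>' k / z ^ k))) \<le> 2 * B / (R ^ n * (R - 1))"
proof -
  define A where "A = {w::complex. 1 / \<theta> < cmod w \<and> cmod w < \<theta>}"
  define r where "r = 1 / R"
  have r: "0 < r" "r < 1" "1 / \<theta> < r" "r < \<theta>" "1 / \<theta> < R" "1 / \<theta> < 1"
    using R by (auto simp: r_def field_simps less_trans[of 1 R] intro: less_trans[of _ 1])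
  have B0: "B \<ge> 0"
    using B[of 1] R r order_trans[OF norm_ge_zero] by simp
  have imR: "path_image (circlepath 0 R) \<subseteq> A" and imr: "path_image (circlepath 0 r) \<subseteq> A"
    using R r by (auto simp: A_def)
  have cont: "continuous_on (path_image (circlepath 0 R)) F" "continuous_on (path_image (circlepath 0 r)) F"
    using F imR imr by (auto simp: A_def intro: continuous_on_subset[OF holomorphic_on_imp_continuous_on])
  have BR: "cmod (F w) \<le> B" if "cmod w = R" for w using that R r by (intro B) auto
  have Br: "cmod (F w) \<le> B" if "cmod w = r" for w using that R r by (intro B) auto
  define c where "c = 2 * of_real pi * \<i>"
  have c0: "c \<noteq> 0" by (simp add: c_def)
  define \<alpha> where "\<alpha> k = contour_integral (circlepath 0 R) (\<lambda>w. F w / w ^ Suc k) / c" for k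
  \<comment> \<open>The value at 0 is a default: the sum of negative powers starts at 1, while the
    coefficient bound is claimed for every \<open>k\<close>.\<close>
  define \<alpha>' where "\<alpha>' k = (if k = 0 then 0 else contour_integral (circlepath 0 r) (\<lambda>w. F w * w ^ (k - 1)) / c)" for k
  have i1: "(\<lambda>w. F w / w ^ Suc k) contour_integrable_on circlepath 0 R" for k
    using R cont by (intro contour_integrable_continuous_circlepath continuous_intros) auto
  have i2: "(\<lambda>w. F w * w ^ k) contour_integrable_on circlepath 0 r" for k
    using R cont by (intro contour_integrable_continuous_circlepath continuous_intros) auto
  show thesis
  proof
    show "cmod (\<alpha> k) \<le> B / R ^ k" for k
    proof -
      have "cmod (\<alpha> k) \<le> B / R ^ Suc k * R"
        unfolding \<alpha>_def c_def using R B0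
        by (intro circle_integral_bound i1) (auto simp: norm_divide norm_mult norm_power BR intro!: divide_right_mono)
      then show ?thesis using R by simp
    qed
    show "cmod (\<alpha>' k) \<le> B / R ^ k" for k
    proof (cases k)
      case 0
      then show ?thesis using B0 R by (simp add: \<alpha>'_def)
    next
      case (Suc j)
      have "cmod (contour_integral (circlepath 0 r) (\<lambda>w. F w * w ^ j) / c) \<le> (B * r ^ j) * r"
        unfolding c_def using r B0
        by (intro circle_integral_bound i2) (auto simp: norm_mult norm_power Br intro!: mult_right_mono)
      also have "\<dots> = B / R ^ k" using R Suc by (simp add: r_def power_divide)
      finally show ?thesis by (simp add: \<alpha>'_def Suc)
    qed
    fix z :: complex assume z: "cmod z = 1"
    have z0: "z \<noteq> 0" using z by auto
    define E1 where "E1 = (\<lambda>w. F w * ((z / w) ^ Suc n / (w - z)))"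
    define E2 where "E2 = (\<lambda>w. F w * ((w / z) ^ n / (z - w)))"
    have iE1: "E1 contour_integrable_on circlepath 0 R"
      unfolding E1_def using R z cont
      by (intro contour_integrable_continuous_circlepath continuous_intros) auto
    have iE2: "E2 contour_integrable_on circlepath 0 r"
      unfolding E2_def using R r z z0 cont
      by (intro contour_integrable_continuous_circlepath continuous_intros) auto
    have "contour_integral (circlepath 0 R) (\<lambda>w. F w / (w - z))
        = contour_integral (circlepath 0 R) (\<lambda>w. (\<Sum>k=0..n. z ^ k * (F w / w ^ Suc k)) + E1 w)"
    proof (rule contour_integral_cong)
      fix w assume "w \<in> path_image (circlepath 0 R)"
      then have w: "cmod w = R" using R by simp
      have "F w * (1 / (w - z)) = F w * ((\<Sum>k=0..n. z ^ k / w ^ Suc k) + (z / w) ^ Suc n / (w - z))"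
        using w R z by (subst geometric_kernel_outer) auto
      then show "F w / (w - z) = (\<Sum>k=0..n. z ^ k * (F w / w ^ Suc k)) + E1 w"
        by (simp add: E1_def distrib_left sum_distrib_left mult_ac)
    qed simp
    also have "\<dots> = (\<Sum>k=0..n. z ^ k * contour_integral (circlepath 0 R) (\<lambda>w. F w / w ^ Suc k))
        + contour_integral (circlepath 0 R) E1"
      using i1 iE1 by (intro contour_integral_sum_plus) auto
    finally have I1: "contour_integral (circlepath 0 R) (\<lambda>w. F w / (w - z)) / c
      = (\<Sum>k=0..n. \<alpha> k * z ^ k) + contour_integral (circlepath 0 R) E1 / c"
      by (simp add: \<alpha>_def add_divide_distrib sum_divide_distrib mult.commute)
    have "- contour_integral (circlepath 0 r) (\<lambda>w. F w / (w - z))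
        = contour_integral (circlepath 0 r) (\<lambda>w. - (F w / (w - z)))"
      by (simp add: contour_integral_neg)
    also have "\<dots> = contour_integral (circlepath 0 r) (\<lambda>w. (\<Sum>k=1..n. 1 / z ^ k * (F w * w ^ (k - 1))) + E2 w)"
    proof (rule contour_integral_cong)
      fix w assume "w \<in> path_image (circlepath 0 r)"
      then have w: "cmod w = r" using r by simp
      have "F w * (1 / (z - w)) = F w * ((\<Sum>k=1..n. w ^ (k - 1) / z ^ k) + (w / z) ^ n / (z - w))"
        using w r z z0 by (subst geometric_kernel_inner) auto
      moreover have "- (F w / (w - z)) = F w * (1 / (z - w))"
        by (metis minus_diff_eq minus_divide_right mult.right_neutral times_divide_eq_right)
      ultimately show "- (F w / (w - z)) = (\<Sum>k=1..n. 1 / z ^ k * (F w * w ^ (k - 1))) + E2 w"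
        by (simp add: E2_def distrib_left sum_distrib_left mult_ac)
    qed simp
    also have "\<dots> = (\<Sum>k=1..n. 1 / z ^ k * contour_integral (circlepath 0 r) (\<lambda>w. F w * w ^ (k - 1)))
        + contour_integral (circlepath 0 r) E2"
      using i2 iE2 by (intro contour_integral_sum_plus) auto
    moreover have \<alpha>': "(\<Sum>k=1..n. \<alpha>' k / z ^ k)
        = (\<Sum>k=1..n. contour_integral (circlepath 0 r) (\<lambda>w. F w * w ^ (k - 1)) / c / z ^ k)"
      by (intro sum.cong) (auto simp: \<alpha>'_def)
    ultimately have I2: "- contour_integral (circlepath 0 r) (\<lambda>w. F w / (w - z)) / c
      = (\<Sum>k=1..n. \<alpha>' k / z ^ k) + contour_integral (circlepath 0 r) E2 / c"
      by (simp add: \<alpha>' add_divide_distrib sum_divide_distrib mult.commute)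
    have "c * F z = contour_integral (circlepath 0 R) (\<lambda>w. F w / (w - z))
        + (- contour_integral (circlepath 0 r) (\<lambda>w. F w / (w - z)))"
      unfolding c_def using cauchy_formula_annulus[OF F, of r z R] R r z by simp
    then have "c * F z / c = contour_integral (circlepath 0 R) (\<lambda>w. F w / (w - z)) / c
        + - contour_integral (circlepath 0 r) (\<lambda>w. F w / (w - z)) / c"
      by (simp only: add_divide_distrib)
    then have "F z - ((\<Sum>k=0..n. \<alpha> k * z ^ k) + (\<Sum>k=1..n. \<alpha>' k / z ^ k))
        = contour_integral (circlepath 0 R) E1 / c + contour_integral (circlepath 0 r) E2 / c"
      using c0 unfolding I1 I2 by simp
    moreover have "cmod (contour_integral (circlepath 0 R) E1 / c) \<le> B / (R ^ Suc n * (R - 1)) * R"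
      unfolding c_def
    proof (rule circle_integral_bound[OF iE1])
      fix w assume w: "cmod w = R"
      have "R - 1 \<le> cmod (w - z)" using norm_triangle_ineq2[of w z] w z by simp
      then have "1 / R ^ Suc n / cmod (w - z) \<le> 1 / R ^ Suc n / (R - 1)"
        using R by (intro divide_left_mono mult_pos_pos) auto
      then have "cmod (F w) * (1 / R ^ Suc n / cmod (w - z)) \<le> B * (1 / R ^ Suc n / (R - 1))"
        using BR[OF w] R B0 by (intro mult_mono) auto
      then show "cmod (E1 w) \<le> B / (R ^ Suc n * (R - 1))"
        by (simp add: E1_def norm_mult norm_divide norm_power w z power_divide)
    qed (use R B0 in auto)
    moreover have "cmod (contour_integral (circlepath 0 r) E2 / c) \<le> B * (r ^ n / (1 - r)) * r"
      unfolding c_def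
    proof (rule circle_integral_bound[OF iE2])
      fix w assume w: "cmod w = r"
      have "1 - r \<le> cmod (z - w)" using norm_triangle_ineq2[of z w] w z by simp
      then have "r ^ n / cmod (z - w) \<le> r ^ n / (1 - r)"
        using r by (intro divide_left_mono mult_pos_pos) auto
      then have "cmod (F w) * (r ^ n / cmod (z - w)) \<le> B * (r ^ n / (1 - r))"
        using Br[OF w] r B0 by (intro mult_mono) auto
      then show "cmod (E2 w) \<le> B * (r ^ n / (1 - r))"
        by (simp add: E2_def norm_mult norm_divide norm_power w z power_divide)
    qed (use r B0 in auto)
    moreover have "B / (R ^ Suc n * (R - 1)) * R = B / (R ^ n * (R - 1))" using R by simp
    moreover have "B * (r ^ n / (1 - r)) * r = B / (R ^ n * (R - 1))"
      using R by (simp add: r_def power_divide field_simps)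
    ultimately show "cmod (F z - ((\<Sum>k=0..n. \<alpha> k * z ^ k) + (\<Sum>k=1..n. \<alpha>' k / z ^ k))) \<le> 2 * B / (R ^ n * (R - 1))"
      using norm_triangle_ineq[of "contour_integral (circlepath 0 R) E1 / c" "contour_integral (circlepath 0 r) E2 / c"]
      by (simp only:)
  qed
qed

section \<open>Approximation on the Bernstein ellipse\<close>

definition joukowski :: "complex \<Rightarrow> complex" where
  "joukowski w = (w + inverse w) / 2"

text \<open>The image of the open annulus is open by the open mapping theorem, and it lies in the
  ellipse since \<open>w\<close> and \<open>1 / w\<close> have the same image. Hence it lies in the
  interior, where \<open>f\<close> is analytic.\<close>

lemma bernstein_ellipse_annulus:
  assumes \<theta>: "\<theta> > 1" and w: "1 / \<theta> < cmod w" "cmod w < \<theta>"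
  shows "joukowski w \<in> interior (bernstein_ellipse \<theta>)"
proof -
  define A where "A = {w::complex. 1 / \<theta> < cmod w \<and> cmod w < \<theta>}"
  have "open A" unfolding A_def by (intro open_Collect_conj open_Collect_less continuous_intros)
  moreover have "connected A" unfolding A_def using connected_annulus(1)[of "1 / \<theta>" "0::complex" \<theta>] by simp
  moreover have nz: "w \<noteq> 0" if "w \<in> A" for w using that \<theta> by (auto simp: A_def)
  then have "joukowski holomorphic_on A"
    unfolding joukowski_def by (intro holomorphic_intros) auto
  moreover have "\<not> joukowski constant_on A"
  proof
    assume "joukowski constant_on A"
    define a where "a = (1 + \<theta>) / 2"
    have a: "1 < a" "a < \<theta>" using \<theta> by (auto simp: a_def)
    have "1 / \<theta> < 1" using \<theta> by simp
    moreover from this a have "1 / \<theta> < a" by linarith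
    ultimately have "1 \<in> A" "of_real a \<in> A" using a \<theta> by (auto simp: A_def)
    then have "joukowski (of_real a) = joukowski 1"
      using \<open>joukowski constant_on A\<close> unfolding constant_on_def by metis
    then have "complex_of_real ((a + inverse a) / 2) = of_real 1" by (simp add: joukowski_def)
    then have "(a + inverse a) / 2 = 1" by (simp only: of_real_eq_iff)
    then have "(a - 1)\<^sup>2 = 0" using a by (simp add: field_simps power2_eq_square)
    then show False using a by simp
  qed
  ultimately have "open (joukowski ` A)" by (intro open_mapping_thm[of joukowski A A]) auto
  moreover have "joukowski ` A \<subseteq> bernstein_ellipse \<theta>"
  proof
    fix y assume "y \<in> joukowski ` A"
    then obtain w where w: "w \<in> A" "y = joukowski w" by auto
    show "y \<in> bernstein_ellipse \<theta>"
    proof (cases "1 \<le> cmod w")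
      case True
      then show ?thesis using w by (auto simp: bernstein_ellipse_def A_def joukowski_def)
    next
      case False
      have "0 < cmod w" "1 < cmod w * \<theta>"
        using w(1) nz[OF w(1)] \<theta> by (auto simp: A_def pos_divide_less_eq)
      moreover have "cmod (inverse w) = 1 / cmod w" by (simp only: inverse_eq_divide norm_divide norm_one)
      ultimately have "1 \<le> cmod (inverse w)" "cmod (inverse w) \<le> \<theta>"
        using False by (simp_all only: le_divide_eq divide_le_eq) (auto simp: mult.commute)
      then show ?thesis using w unfolding bernstein_ellipse_def joukowski_def
        by (intro CollectI exI[of _ "inverse w"]) (auto simp: add.commute)
    qed
  qed
  ultimately have "joukowski ` A \<subseteq> interior (bernstein_ellipse \<theta>)" by (rule interior_maximal[rotated])
  then show ?thesis using w by (auto simp: A_def)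
qed

lemma compact_bernstein_ellipse: "compact (bernstein_ellipse \<theta>)"
proof -
  have "bernstein_ellipse \<theta> = joukowski ` (cball 0 \<theta> - ball 0 1)"
    by (auto simp: bernstein_ellipse_def joukowski_def)
  moreover have "compact (cball (0::complex) \<theta> - ball 0 1)"
    by (intro compact_diff) auto
  moreover have "continuous_on (cball (0::complex) \<theta> - ball 0 1) joukowski"
    unfolding joukowski_def by (intro continuous_intros) auto
  ultimately show ?thesis by (simp add: compact_continuous_image)
qed

text \<open>\<open>f\<close> composed with the Joukowski map is invariant under \<open>w\<close> to
  \<open>1 / w\<close>. Averaging its truncated Laurent expansion at \<open>z\<close> and
  \<open>1 / z\<close> on the unit circle turns powers into Chebyshev polynomials. The radius
  \<sigma> keeps the constants independent of \<open>n\<close>.\<close>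

lemma bernstein_chebyshev_approx:
  assumes \<sigma>: "1 < \<sigma>" "\<sigma> < \<theta>" and f: "f \<in> B_space (bernstein_ellipse \<theta>)"
  defines "F \<equiv> sup_norm (bernstein_ellipse \<theta>) f"
  obtains a where "F \<ge> 0" "\<And>k. cmod (a k) \<le> 2 * F / \<sigma> ^ k"
    "\<And>x. \<bar>x\<bar> \<le> 1 \<Longrightarrow> cmod (f (of_real x) - (\<Sum>k=0..n. a k * of_real (poly (cheb k) x))) \<le> 4 * F / (\<theta> ^ n * (\<sigma> - 1))"
proof -
  define A where "A = {w::complex. 1 / \<theta> < cmod w \<and> cmod w < \<theta>}"
  have \<theta>: "\<theta> > 1" using \<sigma> by simp
  have JA: "joukowski w \<in> interior (bernstein_ellipse \<theta>)" if "w \<in> A" for w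
    using that \<theta> by (auto simp: A_def intro: bernstein_ellipse_annulus)
  have fE: "cmod (f z) \<le> F" if "z \<in> bernstein_ellipse \<theta>" for z
    unfolding F_def sup_norm_def
  proof (rule cSUP_upper[OF that])
    have "compact ((\<lambda>z. cmod (f z)) ` bernstein_ellipse \<theta>)"
      using f by (intro compact_continuous_image compact_bernstein_ellipse continuous_intros) (auto simp: B_space_def)
    then show "bdd_above ((\<lambda>z. cmod (f z)) ` bernstein_ellipse \<theta>)"
      by (intro bounded_imp_bdd_above compact_imp_bounded)
  qed
  define G where "G = (\<lambda>w. f (joukowski w))"
  have "joukowski holomorphic_on A"
    unfolding joukowski_def using \<theta> by (intro holomorphic_intros) (auto simp: A_def)
  moreover have "f holomorphic_on interior (bernstein_ellipse \<theta>)"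
    using f by (simp add: B_space_def analytic_imp_holomorphic)
  ultimately have G: "G holomorphic_on {w. 1 / \<theta> < cmod w \<and> cmod w < \<theta>}"
    unfolding G_def A_def[symmetric] using JA
    by (auto intro!: holomorphic_on_compose_gen[of joukowski A f, unfolded o_def])
  have GB: "cmod (G w) \<le> F" if "1 / \<theta> < cmod w" "cmod w < \<theta>" for w
    using fE JA[of w] interior_subset that by (auto simp: G_def A_def)
  have F0: "F \<ge> 0" using GB[of 1] \<theta> order_trans[OF norm_ge_zero] by simp
  \<comment> \<open>Analyticity is available for radii below \<theta> only. Taking \<open>R\<close>
    so close to \<theta> that \<open>R ^ n\<close> exceeds half of \<open>\<theta> ^ n\<close>
    restores the full rate at the cost of a factor 2; this \<open>R\<close> may depend on
    \<open>n\<close>.\<close>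
  have "((\<lambda>R. R ^ n) \<longlongrightarrow> \<theta> ^ n) (at_left \<theta>)" by (intro tendsto_intros)
  moreover have "\<theta> ^ n / 2 < \<theta> ^ n" using \<theta> by simp
  ultimately have "eventually (\<lambda>R. \<theta> ^ n / 2 < R ^ n) (at_left \<theta>)" by (rule order_tendstoD)
  moreover have "eventually (\<lambda>R. \<sigma> < R \<and> R < \<theta>) (at_left \<theta>)"
    using eventually_at_left_real[OF \<sigma>(2)] by (rule eventually_mono) simp
  ultimately have "eventually (\<lambda>R. \<theta> ^ n / 2 < R ^ n \<and> \<sigma> < R \<and> R < \<theta>) (at_left \<theta>)"
    by (rule eventually_conj)
  then obtain R where R: "\<theta> ^ n / 2 < R ^ n" "\<sigma> < R" "R < \<theta>"
    using eventually_happens trivial_limit_at_left_real by blast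
  have R1: "1 < R" using R \<sigma> by simp
  obtain \<alpha> \<alpha>' where \<alpha>: "\<And>k. cmod (\<alpha> k) \<le> F / R ^ k" "\<And>k. cmod (\<alpha>' k) \<le> F / R ^ k"
    and approx: "\<And>z. cmod z = 1 \<Longrightarrow> cmod (G z - ((\<Sum>k=0..n. \<alpha> k * z ^ k) + (\<Sum>k=1..n. \<alpha>' k / z ^ k))) \<le> 2 * F / (R ^ n * (R - 1))"
    by (rule laurent_truncation[OF G GB R1 R(3), where n = n]) (assumption | rule that)+
  define a' where "a' k = (if k = 0 then 0 else \<alpha>' k)" for k
  show thesis
  proof
    show "F \<ge> 0" by (rule F0)
    show "cmod (\<alpha> k + a' k) \<le> 2 * F / \<sigma> ^ k" for k
    proof -
      have "cmod (a' k) \<le> F / R ^ k" using \<alpha> F0 R1 by (simp add: a'_def)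
      then have "cmod (\<alpha> k + a' k) \<le> 2 * F / R ^ k"
        using \<alpha>(1)[of k] norm_triangle_ineq[of "\<alpha> k" "a' k"] by simp
      also have "\<dots> \<le> 2 * F / \<sigma> ^ k"
        using R R1 \<sigma> F0 by (intro divide_left_mono power_mono mult_pos_pos) auto
      finally show ?thesis .
    qed
    fix x :: real assume x: "\<bar>x\<bar> \<le> 1"
    define t where "t = arccos x"
    have xt: "x = cos t" using x by (simp add: t_def abs_le_iff)
    define z where "z = cis t"
    have z: "cmod z = 1" "z \<noteq> 0" "inverse z = cis (- t)" by (simp_all add: z_def)
    have "joukowski z = of_real x"
      by (simp add: joukowski_def z(3)) (simp add: z_def xt complex_eq_iff)
    then have Gz: "G z = f (of_real x)" "G (inverse z) = f (of_real x)"
      by (simp_all add: G_def joukowski_def add.commute)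
    define S where "S = (\<lambda>z. (\<Sum>k=0..n. \<alpha> k * z ^ k) + (\<Sum>k=1..n. \<alpha>' k / z ^ k))"
    have cheb: "z ^ k + 1 / z ^ k = 2 * of_real (poly (cheb k) x)" for k
    proof -
      have "1 / z ^ k = inverse z ^ k" by (simp add: power_inverse divide_inverse)
      also have "\<dots> = cis (real k * - t)" unfolding z(3) by (rule Complex.DeMoivre)
      finally have e1: "1 / z ^ k = cis (- (real k * t))" by (simp only: mult_minus_right)
      have e2: "z ^ k = cis (real k * t)" unfolding z_def by (rule Complex.DeMoivre)
      show ?thesis
        unfolding xt cheb_cos e1 unfolding e2 complex_eq_iff by simp
    qed
    have a's: "(\<Sum>k=1..n. \<alpha>' k * h k) = (\<Sum>k=0..n. a' k * h k)" for h
      by (intro sum.mono_neutral_cong_left) (auto simp: a'_def)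
    have "S z + S (inverse z) = (\<Sum>k=0..n. \<alpha> k * (z ^ k + 1 / z ^ k)) + (\<Sum>k=1..n. \<alpha>' k * (z ^ k + 1 / z ^ k))"
      by (simp add: S_def distrib_left sum.distrib power_inverse divide_inverse)
    also have "\<dots> = (\<Sum>k=0..n. (\<alpha> k + a' k) * (2 * of_real (poly (cheb k) x)))"
      unfolding a's cheb by (simp add: distrib_right sum.distrib)
    also have "\<dots> = 2 * (\<Sum>k=0..n. (\<alpha> k + a' k) * of_real (poly (cheb k) x))"
      unfolding sum_distrib_left by (intro sum.cong) auto
    finally have SS: "S z + S (inverse z) = 2 * (\<Sum>k=0..n. (\<alpha> k + a' k) * of_real (poly (cheb k) x))" .
    have S: "2 * (f (of_real x) - (\<Sum>k=0..n. (\<alpha> k + a' k) * of_real (poly (cheb k) x)))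
        = (G z - S z) + (G (inverse z) - S (inverse z))"
      by (simp only: right_diff_distrib SS[symmetric] Gz) simp
    have "cmod (2 * (f (of_real x) - (\<Sum>k=0..n. (\<alpha> k + a' k) * of_real (poly (cheb k) x))))
        \<le> cmod (G z - S z) + cmod (G (inverse z) - S (inverse z))"
      unfolding S by (rule norm_triangle_ineq)
    also have "\<dots> \<le> 2 * F / (R ^ n * (R - 1)) + 2 * F / (R ^ n * (R - 1))"
      unfolding S_def using z by (intro add_mono approx) (auto simp: norm_inverse)
    finally have "cmod (f (of_real x) - (\<Sum>k=0..n. (\<alpha> k + a' k) * of_real (poly (cheb k) x)))
        \<le> 2 * F / (R ^ n * (R - 1))"
      unfolding norm_mult norm_numeral by linarith
    also have "\<dots> \<le> 2 * F / (\<theta> ^ n / 2 * (\<sigma> - 1))"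
      using R R1 \<sigma> \<theta> F0 by (intro divide_left_mono mult_mono mult_pos_pos) auto
    finally show "cmod (f (of_real x) - (\<Sum>k=0..n. (\<alpha> k + a' k) * of_real (poly (cheb k) x)))
        \<le> 4 * F / (\<theta> ^ n * (\<sigma> - 1))"
      by simp
  qed
qed

section \<open>The approximation error\<close>

text \<open>Each Chebyshev polynomial is bounded by a power of \<tau> on [-\<gamma>, \<gamma>], so
  \<open>psi_expansion\<close> bounds its coefficient vector; the vectors are then added with
  weights \<open>a k\<close>.\<close>

lemma chebyshev_sum_psi_coeffs:
  fixes a :: "nat \<Rightarrow> complex"
  assumes g: "\<gamma> > 1" and W: "(\<Sum>k=0..n. cmod (a k) * (\<gamma> + sqrt (\<gamma>\<^sup>2 - 1)) ^ k) \<le> W"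
  obtains u where "u \<in> carrier_vec (n + 1)" "sqn u \<le> (sqrt (2 * \<gamma>) * W)\<^sup>2"
    "\<And>x. (\<Sum>k=0..n. a k * of_real (poly (cheb k) x)) = (\<Sum>i=0..n. vec_index u i * of_real (psi \<gamma> i x))"
proof -
  define \<tau> where "\<tau> = \<gamma> + sqrt (\<gamma>\<^sup>2 - 1)"
  have \<tau>: "\<tau> > 0" using g by (simp add: \<tau>_def add_pos_nonneg one_le_power)
  have "\<exists>t. \<forall>k\<in>{0..n}. (\<forall>x. poly (cheb k) x = (\<Sum>i\<le>n. t k i * psi \<gamma> i x)) \<and> (\<Sum>i\<le>n. (t k i)\<^sup>2) \<le> 2 * \<gamma> * (\<tau> ^ k)\<^sup>2"
  proof (rule bchoice, rule ballI)
    fix k assume "k \<in> {0..n}"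
    then have "Polynomial.degree (cheb k) \<le> n" using degree_cheb[of k] by simp
    then obtain t where "\<And>x. poly (cheb k) x = (\<Sum>i\<le>n. t i * psi \<gamma> i x)" "(\<Sum>i\<le>n. (t i)\<^sup>2) \<le> 2 * \<gamma> * (\<tau> ^ k)\<^sup>2"
      using g abs_cheb_le[of _ \<gamma> k] by (elim psi_expansion[of "cheb k" n \<gamma> "\<tau> ^ k"]) (auto simp: \<tau>_def)
    then show "\<exists>t. (\<forall>x. poly (cheb k) x = (\<Sum>i\<le>n. t i * psi \<gamma> i x)) \<and> (\<Sum>i\<le>n. (t i)\<^sup>2) \<le> 2 * \<gamma> * (\<tau> ^ k)\<^sup>2"
      by blast
  qed
  then obtain t where t: "\<And>k x. k \<le> n \<Longrightarrow> poly (cheb k) x = (\<Sum>i\<le>n. t k i * psi \<gamma> i x)"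
    "\<And>k. k \<le> n \<Longrightarrow> (\<Sum>i\<le>n. (t k i)\<^sup>2) \<le> 2 * \<gamma> * (\<tau> ^ k)\<^sup>2"
    by auto
  define u where "u = Matrix.vec (n + 1) (\<lambda>i. \<Sum>k=0..n. a k * of_real (t k i))"
  define w where "w k = cmod (a k) * \<tau> ^ k" for k
  define v where "v k = cmod (a k) / \<tau> ^ k" for k
  have w0: "w k \<ge> 0" "v k \<ge> 0" for k using \<tau> by (simp_all add: w_def v_def)
  have wv: "sqrt (w k) * sqrt (v k) = cmod (a k)" for k
    using \<tau> by (simp add: w_def v_def flip: real_sqrt_mult)
  have set: "{..<n + 1} = {..n}" by auto
  show thesis
  proof
    show "u \<in> carrier_vec (n + 1)" by (simp add: u_def)
    (* Minkowski's inequality, obtained from Cauchy--Schwarz with the weights w and v. *)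
    have "sqn u = (\<Sum>i\<le>n. (cmod (\<Sum>k=0..n. a k * of_real (t k i)))\<^sup>2)"
      unfolding sqn_def using set by (auto simp: u_def intro!: sum.cong)
    also have "\<dots> \<le> (\<Sum>i\<le>n. (\<Sum>k=0..n. w k) * (\<Sum>k=0..n. v k * (t k i)\<^sup>2))"
    proof (rule sum_mono)
      fix i
      have "cmod (\<Sum>k=0..n. a k * of_real (t k i)) \<le> (\<Sum>k=0..n. sqrt (w k) * (sqrt (v k) * \<bar>t k i\<bar>))"
        using norm_sum[of "\<lambda>k. a k * of_real (t k i)" "{0..n}"]
        by (simp add: norm_mult mult.assoc[symmetric] wv)
      then have "(cmod (\<Sum>k=0..n. a k * of_real (t k i)))\<^sup>2 \<le> (\<Sum>k=0..n. sqrt (w k) * (sqrt (v k) * \<bar>t k i\<bar>))\<^sup>2"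
        by (intro power_mono) auto
      also have "\<dots> \<le> (\<Sum>k=0..n. (sqrt (w k))\<^sup>2) * (\<Sum>k=0..n. (sqrt (v k) * \<bar>t k i\<bar>)\<^sup>2)"
        by (rule Cauchy_Schwarz_ineq_sum)
      finally show "(cmod (\<Sum>k=0..n. a k * of_real (t k i)))\<^sup>2 \<le> (\<Sum>k=0..n. w k) * (\<Sum>k=0..n. v k * (t k i)\<^sup>2)"
        using w0 by (simp add: power_mult_distrib)
    qed
    also have "\<dots> = (\<Sum>k=0..n. w k) * (\<Sum>k=0..n. v k * (\<Sum>i\<le>n. (t k i)\<^sup>2))"
      unfolding sum_distrib_left[symmetric] by (subst sum.swap) (simp add: sum_distrib_left)
    also have "\<dots> \<le> (\<Sum>k=0..n. w k) * (\<Sum>k=0..n. v k * (2 * \<gamma> * (\<tau> ^ k)\<^sup>2))"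
      using w0 t(2) by (intro mult_left_mono sum_mono sum_nonneg) auto
    also have "(\<Sum>k=0..n. v k * (2 * \<gamma> * (\<tau> ^ k)\<^sup>2)) = 2 * \<gamma> * (\<Sum>k=0..n. w k)"
      unfolding sum_distrib_left using \<tau> by (intro sum.cong) (auto simp: v_def w_def power2_eq_square)
    also have "(\<Sum>k=0..n. w k) * (2 * \<gamma> * (\<Sum>k=0..n. w k)) = 2 * \<gamma> * (\<Sum>k=0..n. w k)\<^sup>2"
      by (simp add: power2_eq_square)
    also have "\<dots> \<le> 2 * \<gamma> * W\<^sup>2"
      using W g w0 by (intro mult_left_mono power_mono) (auto simp: w_def \<tau>_def intro!: sum_nonneg)
    finally show "sqn u \<le> (sqrt (2 * \<gamma>) * W)\<^sup>2" using g by (simp add: power_mult_distrib)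
    fix x
    have "(\<Sum>k=0..n. a k * of_real (poly (cheb k) x)) = (\<Sum>k=0..n. \<Sum>i\<le>n. a k * of_real (t k i) * of_real (psi \<gamma> i x))"
      by (intro sum.cong) (auto simp: t(1) sum_distrib_left mult.assoc)
    also have "\<dots> = (\<Sum>i\<le>n. (\<Sum>k=0..n. a k * of_real (t k i)) * of_real (psi \<gamma> i x))"
      by (subst sum.swap) (simp add: sum_distrib_right)
    also have "\<dots> = (\<Sum>i=0..n. vec_index u i * of_real (psi \<gamma> i x))"
      by (intro sum.cong) (auto simp: u_def)
    finally show "(\<Sum>k=0..n. a k * of_real (poly (cheb k) x)) = (\<Sum>i=0..n. vec_index u i * of_real (psi \<gamma> i x))" .
  qed
qed

lemma geometric_sum_le:
  fixes q :: real
  assumes "0 \<le> q" "q < 1"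
  shows "(\<Sum>k=0..n. q ^ k) \<le> 1 / (1 - q)"
proof -
  have "(\<Sum>k=0..n. q ^ k) = (1 - q ^ Suc n) / (1 - q)"
    using assms sum_gp0[of q n] by (simp add: atMost_atLeast0)
  then show ?thesis using assms by (simp add: divide_right_mono)
qed

text \<open>A radius strictly between \<tau> = \<open>\<gamma> + sqrt (\<gamma>\<^sup>2 - 1)\<close>
  and \<theta>: below \<theta> for the Chebyshev approximation, above \<tau> so that the weighted
  coefficient sum is dominated by a convergent geometric series.\<close>

definition approx_radius :: "real \<Rightarrow> real \<Rightarrow> real" where
  "approx_radius \<theta> \<gamma> = (\<theta> + (\<gamma> + sqrt (\<gamma>\<^sup>2 - 1))) / 2"

text \<open>The first summand comes from the Chebyshev truncation error, the second is twice the
  bound for the weighted coefficient sum.\<close>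

definition approx_const :: "real \<Rightarrow> real \<Rightarrow> real" where
  "approx_const \<theta> \<gamma> = 4 / (approx_radius \<theta> \<gamma> - 1)
    + 2 * (2 / (1 - (\<gamma> + sqrt (\<gamma>\<^sup>2 - 1)) / approx_radius \<theta> \<gamma>))"

lemma frame_approx_analytic_error:
  fixes \<beta> \<epsilon> \<epsilon>' \<gamma> \<theta> :: real
  assumes CR: "CR_constant \<beta>" and eps: "0 < \<epsilon>" "\<epsilon> \<le> 1 / exp 1" and g: "\<gamma> > 1"
    and n: "real n \<ge> sqrt (\<gamma>\<^sup>2 - 1) * ln (1 / \<epsilon>)" "n > 0"
    and m: "real m \<ge> 36 * real n * ln (1 / \<epsilon>) / sqrt (\<gamma>\<^sup>2 - 1)" "m > 0"
    and eps': "\<epsilon>' = \<epsilon> * (real n + 1) / sqrt \<gamma>"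
    and svd: "is_svd (frame_mat \<gamma> m n) U S V"
    and \<theta>: "\<theta> > \<gamma> + sqrt (\<gamma>\<^sup>2 - 1)" and f: "f \<in> B_space (bernstein_ellipse \<theta>)"
  defines "F \<equiv> sup_norm (bernstein_ellipse \<theta>) f"
  shows "F \<ge> 0" "approx_const \<theta> \<gamma> \<ge> 0"
    "sup_norm {-1..1} (\<lambda>x. restrict_real f x - frame_approx U S V \<epsilon>' \<gamma> m n (restrict_real f) x)
      \<le> (4 * \<beta> + 3) * approx_const \<theta> \<gamma> * sqrt (real m) * (\<theta> powr (- real n) + real n * \<epsilon>) * F"
proof -
  define \<tau> where "\<tau> = \<gamma> + sqrt (\<gamma>\<^sup>2 - 1)"
  define \<sigma> where "\<sigma> = approx_radius \<theta> \<gamma>"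
  have "sqrt (\<gamma>\<^sup>2 - 1) > 0" using g by (simp add: one_less_power)
  then have \<tau>: "\<tau> > 1" using g unfolding \<tau>_def by linarith
  have \<sigma>: "\<tau> < \<sigma>" "\<sigma> < \<theta>" "1 < \<sigma>" using \<theta> \<tau> by (auto simp: \<sigma>_def approx_radius_def \<tau>_def)
  have \<tau>\<sigma>: "0 \<le> \<tau> / \<sigma>" "\<tau> / \<sigma> < 1" using \<sigma> \<tau> by auto
  define C1 where "C1 = 4 / (\<sigma> - 1)"
  define C2 where "C2 = 2 / (1 - \<tau> / \<sigma>)"
  have C: "C1 \<ge> 0" "C2 \<ge> 0" "approx_const \<theta> \<gamma> = C1 + 2 * C2"
    using \<sigma> \<tau>\<sigma> by (simp_all add: C1_def C2_def approx_const_def \<sigma>_def \<tau>_def)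
  then show "approx_const \<theta> \<gamma> \<ge> 0" by simp
  obtain a where F0: "F \<ge> 0" and a: "\<And>k. cmod (a k) \<le> 2 * F / \<sigma> ^ k"
    and fa: "\<And>x. \<bar>x\<bar> \<le> 1 \<Longrightarrow> cmod (f (of_real x) - (\<Sum>k=0..n. a k * of_real (poly (cheb k) x))) \<le> 4 * F / (\<theta> ^ n * (\<sigma> - 1))"
    by (rule bernstein_chebyshev_approx[OF \<sigma>(3,2) f, where n = n, folded F_def]) (assumption | rule that)+
  show "F \<ge> 0" by (rule F0)
  define q where "q = \<theta> powr (- real n)"
  define E where "E = C1 * q * F"
  have q0: "q \<ge> 0" by (simp add: q_def)
  have E0: "E \<ge> 0" using C F0 q0 by (simp add: E_def)
  have qn: "q = 1 / \<theta> ^ n"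
    using \<tau> \<sigma> by (simp add: q_def powr_minus powr_realpow inverse_eq_divide)
  have E: "4 * F / (\<theta> ^ n * (\<sigma> - 1)) = E" by (simp add: E_def C1_def qn)
  have "(\<Sum>k=0..n. cmod (a k) * \<tau> ^ k) \<le> (\<Sum>k=0..n. 2 * F * (\<tau> / \<sigma>) ^ k)"
  proof (rule sum_mono)
    fix k
    have "cmod (a k) * \<tau> ^ k \<le> 2 * F / \<sigma> ^ k * \<tau> ^ k"
      using a \<tau> by (intro mult_right_mono) auto
    then show "cmod (a k) * \<tau> ^ k \<le> 2 * F * (\<tau> / \<sigma>) ^ k" by (simp add: power_divide)
  qed
  also have "\<dots> = 2 * F * (\<Sum>k=0..n. (\<tau> / \<sigma>) ^ k)" by (simp add: sum_distrib_left)
  also have "\<dots> \<le> 2 * F * (1 / (1 - \<tau> / \<sigma>))"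
    using F0 geometric_sum_le[OF \<tau>\<sigma>] by (intro mult_left_mono) auto
  finally have W: "(\<Sum>k=0..n. cmod (a k) * (\<gamma> + sqrt (\<gamma>\<^sup>2 - 1)) ^ k) \<le> C2 * F"
    by (simp add: C2_def \<tau>_def)
  obtain u where u: "u \<in> carrier_vec (n + 1)" "sqn u \<le> (sqrt (2 * \<gamma>) * (C2 * F))\<^sup>2"
    "\<And>x. (\<Sum>k=0..n. a k * of_real (poly (cheb k) x)) = (\<Sum>i=0..n. vec_index u i * of_real (psi \<gamma> i x))"
    by (rule chebyshev_sum_psi_coeffs[OF g W]) (assumption | rule that)+
  define X where "X = sqrt (2 * \<gamma>) * (C2 * F)"
  have X0: "X \<ge> 0" using g C F0 by (simp add: X_def)
  have \<beta>: "\<beta> > 1" using CR by (simp add: CR_constant_def)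
  \<comment> \<open>Replaces \<open>sqrt (m + 1)\<close> by \<open>2 * sqrt m\<close>; with
    \<open>n + 1 \<le> 2 n\<close> this produces the factor 4 in front of \<open>C2 * F\<close>
    below.\<close>
  have "real m + 1 \<le> 4 * real m" using m by simp
  then have "sqrt (real m + 1) \<le> sqrt (4 * real m)" by (rule real_sqrt_le_mono)
  then have sm: "sqrt (real m + 1) \<le> 2 * sqrt (real m)" by (simp add: real_sqrt_mult)
  have sm1: "sqrt (real m) \<ge> 1" using m by simp
  have "sqrt ((real m + 1) / 2) * (\<epsilon>' * X) = sqrt (real m + 1) * (\<epsilon> * (real n + 1) * (C2 * F))"
    using g by (simp add: X_def eps' real_sqrt_divide real_sqrt_mult)
  also have "\<dots> \<le> 2 * sqrt (real m) * (\<epsilon> * (2 * real n) * (C2 * F))"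
    using sm n eps C F0 by (intro mult_mono mult_left_mono mult_right_mono) auto
  finally have X: "sqrt ((real m + 1) / 2) * (\<epsilon>' * X) \<le> sqrt (real m) * (real n * \<epsilon>) * (4 * (C2 * F))"
    by (simp add: mult_ac)
  have err: "cmod (restrict_real f x - frame_approx U S V \<epsilon>' \<gamma> m n (restrict_real f) x)
      \<le> (4 * \<beta> + 3) * approx_const \<theta> \<gamma> * sqrt (real m) * (q + real n * \<epsilon>) * F"
    if x: "\<bar>x\<bar> \<le> 1" for x
  proof -
    have "cmod (restrict_real f x - frame_approx U S V \<epsilon>' \<gamma> m n (restrict_real f) x)
      \<le> E + (2 * \<beta> + 1) * (sqrt ((real m + 1) / 2) * (\<epsilon>' * X)) + (2 * \<beta> + 1) * sqrt (real m + 1) * E"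
      using fa u(3) E
      by (intro frame_approx_error[OF CR eps g n(1) m(1) eps' svd _ u(1) _ X0 m(2) x])
        (auto simp: restrict_real_def X_def u(2))
    also have "\<dots> \<le> sqrt (real m) * E + (2 * \<beta> + 1) * (sqrt (real m) * (real n * \<epsilon>) * (4 * (C2 * F)))
        + (2 * \<beta> + 1) * (2 * sqrt (real m)) * E"
      using sm sm1 X \<beta> E0 mult_right_mono[of 1 "sqrt (real m)" E]
      by (intro add_mono mult_left_mono mult_right_mono) auto
    \<comment> \<open>The constant \<open>4 * \<beta> + 3\<close> is 1 from the approximation error
      plus twice \<open>2 * \<beta> + 1\<close> from its amplification.\<close>
    also have "\<dots> = sqrt (real m) * F * ((4 * \<beta> + 3) * (C1 * q) + (4 * \<beta> + 2) * (2 * C2 * (real n * \<epsilon>)))"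
      by (simp add: E_def algebra_simps)
    also have "\<dots> \<le> sqrt (real m) * F * ((4 * \<beta> + 3) * (approx_const \<theta> \<gamma> * q) + (4 * \<beta> + 3) * (approx_const \<theta> \<gamma> * (real n * \<epsilon>)))"
      using C F0 q0 \<beta> eps
      by (intro mult_left_mono add_mono mult_mono mult_right_mono) auto
    also have "\<dots> = (4 * \<beta> + 3) * approx_const \<theta> \<gamma> * sqrt (real m) * (q + real n * \<epsilon>) * F"
      by (simp add: algebra_simps)
    finally show ?thesis .
  qed
  show "sup_norm {-1..1} (\<lambda>x. restrict_real f x - frame_approx U S V \<epsilon>' \<gamma> m n (restrict_real f) x)
      \<le> (4 * \<beta> + 3) * approx_const \<theta> \<gamma> * sqrt (real m) * (\<theta> powr (- real n) + real n * \<epsilon>) * F"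
    unfolding sup_norm_def by (rule cSUP_least) (auto simp: abs_le_iff q_def[symmetric] intro!: err)
qed

theorem theorem2p5:
  shows "\<exists>g :: real \<Rightarrow> real \<Rightarrow> real.
    \<forall>(\<beta>::real) (\<epsilon>::real) (\<gamma>::real) (n::nat) (m::nat) (\<epsilon>'::real) (c::real)
      (U::complex mat) (S::complex mat) (V::complex mat).
      CR_constant \<beta> \<and> 0 < \<epsilon> \<and> \<epsilon> \<le> 1 / exp 1 \<and> \<gamma> > 1 \<and>
      real n \<ge> sqrt (\<gamma>\<^sup>2 - 1) * ln (1 / \<epsilon>) \<and>
      m = nat \<lceil>36 * real n * ln (1 / \<epsilon>) / sqrt (\<gamma>\<^sup>2 - 1)\<rceil> \<and>
      \<epsilon>' = \<epsilon> * (real n + 1) / sqrt \<gamma> \<and>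
      c = 4 * \<beta> + 3 \<and>
      is_svd (frame_mat \<gamma> m n) U S V
      \<longrightarrow>
      cond_number m (frame_approx U S V \<epsilon>' \<gamma> m n) \<le> ereal (c * sqrt (real m + 1)) \<and>
      (\<forall>(\<theta>::real) (f::complex \<Rightarrow> complex).
        \<theta> > \<gamma> + sqrt (\<gamma>\<^sup>2 - 1) \<and> f \<in> B_space (bernstein_ellipse \<theta>) \<longrightarrow>
        (let err = sup_norm {-1..1}
               (\<lambda>x. restrict_real f x - frame_approx U S V \<epsilon>' \<gamma> m n (restrict_real f) x);
             cstar = sqrt (\<gamma>\<^sup>2 - 1) / (36 * ln (1 / \<epsilon>));
             \<rho> = \<theta> powr cstar
         in err \<le> c * g \<theta> \<gamma> * sqrt (real m) * (\<theta> powr (- real n) + real n * \<epsilon>)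
                  * sup_norm (bernstein_ellipse \<theta>) f \<and>
            err \<le> c * g \<theta> \<gamma> * sqrt (real m) * (\<rho> powr (1 - real m) + real m * \<epsilon>)
                  * sup_norm (bernstein_ellipse \<theta>) f))"
\<comment> \<open>The factor \<open>1 + sqrt (\<gamma>\<^sup>2 - 1) / 36\<close> serves the second
  error bound, where \<open>n * \<epsilon>\<close> is replaced by a multiple of
  \<open>m * \<epsilon>\<close>; being at least 1, it preserves the first.\<close>
proof (rule exI[of _ "\<lambda>\<theta> \<gamma>. approx_const \<theta> \<gamma> * (1 + sqrt (\<gamma>\<^sup>2 - 1) / 36)"], intro allI impI, elim conjE)
  fix \<beta> \<epsilon> \<gamma> :: real and n m :: nat and \<epsilon>' c :: real and U S V :: "complex mat"
  assume CR: "CR_constant \<beta>" and eps: "0 < \<epsilon>" "\<epsilon> \<le> 1 / exp 1" and g: "1 < \<gamma>"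
    and n: "real n \<ge> sqrt (\<gamma>\<^sup>2 - 1) * ln (1 / \<epsilon>)"
    and m: "m = nat \<lceil>36 * real n * ln (1 / \<epsilon>) / sqrt (\<gamma>\<^sup>2 - 1)\<rceil>"
    and eps': "\<epsilon>' = \<epsilon> * (real n + 1) / sqrt \<gamma>" and c: "c = 4 * \<beta> + 3"
    and svd: "is_svd (frame_mat \<gamma> m n) U S V"
  define s where "s = sqrt (\<gamma>\<^sup>2 - 1)"
  define L where "L = ln (1 / \<epsilon>)"
  have s: "s > 0" using g by (simp add: s_def one_less_power)
  have "exp 1 \<le> 1 / \<epsilon>" using eps by (simp add: field_simps)
  then have "ln (exp 1) \<le> L" unfolding L_def using eps by (subst ln_le_cancel_iff) auto
  then have L: "L \<ge> 1" by simp
  have "s * L > 0" using s L by simp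
  then have "real n > 0" using n unfolding s_def[symmetric] L_def[symmetric] by linarith
  then have n0: "n > 0" by simp
  have t: "36 * real n * L / s > 0" using n0 L s by simp
  have m1: "36 * real n * L / s \<le> real m" "real m \<le> 36 * real n * L / s + 1"
    using t unfolding m L_def[symmetric] s_def[symmetric] by linarith+
  then have m0: "m > 0" using t by (cases m) auto
  have \<beta>: "\<beta> > 1" using CR by (simp add: CR_constant_def)
  note m' = m1(1)[unfolded L_def s_def]
  have "cond_number m (frame_approx U S V \<epsilon>' \<gamma> m n) \<le> ereal ((2 * \<beta> + 1) * sqrt (real m + 1))"
    by (intro cond_number_le frame_approx_add[OF CR eps g n m' eps' svd]
        frame_approx_scale[OF CR eps g n m' eps' svd] frame_approx_bound[OF CR eps g n m' eps' svd])
  also have "\<dots> \<le> ereal (c * sqrt (real m + 1))"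
    using \<beta> by (simp add: c mult_right_mono)
  finally have kappa: "cond_number m (frame_approx U S V \<epsilon>' \<gamma> m n) \<le> ereal (c * sqrt (real m + 1))" .
  have errs: "err \<le> c * (approx_const \<theta> \<gamma> * (1 + sqrt (\<gamma>\<^sup>2 - 1) / 36)) * sqrt (real m) * (\<theta> powr (- real n) + real n * \<epsilon>)
                  * sup_norm (bernstein_ellipse \<theta>) f \<and>
            err \<le> c * (approx_const \<theta> \<gamma> * (1 + sqrt (\<gamma>\<^sup>2 - 1) / 36)) * sqrt (real m) * (\<rho> powr (1 - real m) + real m * \<epsilon>)
                  * sup_norm (bernstein_ellipse \<theta>) f"
    if \<theta>: "\<theta> > \<gamma> + sqrt (\<gamma>\<^sup>2 - 1)" and f: "f \<in> B_space (bernstein_ellipse \<theta>)"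
      and err: "err = sup_norm {-1..1} (\<lambda>x. restrict_real f x - frame_approx U S V \<epsilon>' \<gamma> m n (restrict_real f) x)"
      and \<rho>: "\<rho> = \<theta> powr (sqrt (\<gamma>\<^sup>2 - 1) / (36 * ln (1 / \<epsilon>)))" for \<theta> f err \<rho>
  proof -
    define F where "F = sup_norm (bernstein_ellipse \<theta>) f"
    define K where "K = c * approx_const \<theta> \<gamma> * sqrt (real m)"
    note A = frame_approx_analytic_error[OF CR eps g n n0 m' m0 eps' svd \<theta> f, folded F_def c err]
    have F0: "F \<ge> 0" by (rule A(1))
    have K0: "K \<ge> 0" using A(2) \<beta> by (simp add: K_def c)
    have \<theta>1: "\<theta> > 1" using \<theta> g s unfolding s_def by linarith
    have e: "err \<le> K * (\<theta> powr (- real n) + real n * \<epsilon>) * F"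
      using A(3) by (simp add: K_def)
    have "1 * (\<theta> powr (- real n) + real n * \<epsilon>) \<le> (1 + s / 36) * (\<theta> powr (- real n) + real n * \<epsilon>)"
      using s eps by (intro mult_right_mono) auto
    then have "K * (\<theta> powr (- real n) + real n * \<epsilon>) * F \<le> K * ((1 + s / 36) * (\<theta> powr (- real n) + real n * \<epsilon>)) * F"
      using K0 F0 by (intro mult_right_mono mult_left_mono) auto
    then have 1: "err \<le> K * ((1 + s / 36) * (\<theta> powr (- real n) + real n * \<epsilon>)) * F"
      using e by simp
    \<comment> \<open>The ceiling adds less than 1, so \<open>m - 1\<close> times the exponent
      \<open>s / (36 L)\<close> is at most \<open>n\<close>. This is the source of the exponent
      \<open>1 - m\<close>.\<close>
    have "real m - 1 \<le> 36 * L / s * real n" using m1(2) by (simp add: mult_ac)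
    then have "s / (36 * L) * (real m - 1) \<le> s / (36 * L) * (36 * L / s * real n)"
      using s L by (intro mult_left_mono) auto
    moreover have "s / (36 * L) * (36 * L / s * real n) = real n" using s L by simp
    moreover have "s / (36 * L) * (1 - real m) = - (s / (36 * L) * (real m - 1))"
      by (simp only: mult_minus_right[symmetric] minus_diff_eq)
    ultimately have "- real n \<le> s / (36 * L) * (1 - real m)"
      by linarith
    then have "\<theta> powr (- real n) \<le> \<theta> powr (s / (36 * L) * (1 - real m))"
      using \<theta>1 by (intro powr_mono) auto
    also have "\<dots> = \<rho> powr (1 - real m)" by (simp add: \<rho> s_def L_def powr_powr)
    finally have p: "\<theta> powr (- real n) \<le> \<rho> powr (1 - real m)" .
    \<comment> \<open>Since \<open>L \<ge> 1\<close>, the choice of \<open>m\<close> forces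
      \<open>n \<le> s / 36 * m\<close>.\<close>
    have "36 * real n * 1 / s \<le> 36 * real n * L / s"
      using s L by (intro divide_right_mono mult_left_mono) auto
    then have "36 * real n / s \<le> real m" using m1(1) by simp
    then have "real n \<le> s / 36 * real m" using s by (simp add: divide_le_eq mult_ac)
    then have "real n * \<epsilon> \<le> s / 36 * real m * \<epsilon>" using eps by (intro mult_right_mono) auto
    moreover have "0 \<le> s / 36 * \<rho> powr (1 - real m)" "0 \<le> real m * \<epsilon>" using s eps by auto
    ultimately have "\<theta> powr (- real n) + real n * \<epsilon> \<le> (1 + s / 36) * (\<rho> powr (1 - real m) + real m * \<epsilon>)"
      using p by (simp add: distrib_left distrib_right)
    then have "K * (\<theta> powr (- real n) + real n * \<epsilon>) * F \<le> K * ((1 + s / 36) * (\<rho> powr (1 - real m) + real m * \<epsilon>)) * F"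
      using K0 F0 by (intro mult_right_mono mult_left_mono) auto
    then have 2: "err \<le> K * ((1 + s / 36) * (\<rho> powr (1 - real m) + real m * \<epsilon>)) * F"
      using e by simp
    have "K * ((1 + s / 36) * y) * F = c * (approx_const \<theta> \<gamma> * (1 + s / 36)) * sqrt (real m) * y * F" for y
      by (simp add: K_def mult_ac)
    then show ?thesis using 1 2 by (simp only: F_def s_def)
  qed
  show "cond_number m (frame_approx U S V \<epsilon>' \<gamma> m n) \<le> ereal (c * sqrt (real m + 1)) \<and>
      (\<forall>(\<theta>::real) (f::complex \<Rightarrow> complex).
        \<theta> > \<gamma> + sqrt (\<gamma>\<^sup>2 - 1) \<and> f \<in> B_space (bernstein_ellipse \<theta>) \<longrightarrow>
        (let err = sup_norm {-1..1}
               (\<lambda>x. restrict_real f x - frame_approx U S V \<epsilon>' \<gamma> m n (restrict_real f) x);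
             cstar = sqrt (\<gamma>\<^sup>2 - 1) / (36 * ln (1 / \<epsilon>));
             \<rho> = \<theta> powr cstar
         in err \<le> c * (approx_const \<theta> \<gamma> * (1 + sqrt (\<gamma>\<^sup>2 - 1) / 36)) * sqrt (real m) * (\<theta> powr (- real n) + real n * \<epsilon>)
                  * sup_norm (bernstein_ellipse \<theta>) f \<and>
            err \<le> c * (approx_const \<theta> \<gamma> * (1 + sqrt (\<gamma>\<^sup>2 - 1) / 36)) * sqrt (real m) * (\<rho> powr (1 - real m) + real m * \<epsilon>)
                  * sup_norm (bernstein_ellipse \<theta>) f))"
    unfolding Let_def using kappa errs by blast
qed

end
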